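(* Let $n\ge 2$, $0<a<A$, let $f\in C^\infty(\mathbb{R}^n)$, let $G=\mathcal{R}(f)$ be its spherical mean transform, and let $f_{ml}(r)$ and $g_{ml}(r,t)$ be the coefficients in the spherical harmonic decompositions $$f(x)=\sum_{m=0}^\infty\sum_{l=1}^{l_m} f_{ml}(r)\,r^m\,Y^m_l(\theta),\qquad G(x,t)=\sum_{m=0}^\infty\sum_{l=1}^{l_m} g_{ml}(r,t)\,r^m\,Y^m_l(\theta),\qquad r=|x|,\ \theta=x/|x|.$$ For $m\ge 1$, $1\le l\le l_m$ and $r>0$ let $$k_{ml}(r)=\frac{n(n+2)\cdots[n+2(m-1)]}{2^{m-1}(m-1)!}\,r^{-[n+2(m-1)]}\int_a^r g_{ml}(0,\tau)\,\tau^{n-1}(r^2-\tau^2)^{m-1}\,d\tau,$$ and for $m=0$ let $k_{0l}(r)=g_{0l}(0,r)$. Then for every $m\ge 0$ and $1\le l\le l_m$ there are constants $c^i_{ml}$ ($0\le i\le m-1$) such that for all $r>0$ $$q_{ml}(r):=f_{ml}(r)-k_{ml}(r)=\begin{cases}\displaystyle\sum_{i=0}^{m-1}c^i_{ml}\,r^{-n-2i}, & \text{if } m\ge 1,\\[2mm] 0, & \text{if } m=0.\end{cases}$$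
   Context: For $x\in\mathbb{R}^n$ and $t>0$, $S(x,t)\subset\mathbb{R}^n$ is the sphere of radius $t$ centered at $x$, $d\sigma$ its surface measure and $|S(x,t)|$ its total measure. The spherical mean transform of $f$ is $\mathcal{R}(f)(x,t)=\frac{1}{|S(x,t)|}\int_{S(x,t)}f(y)\,d\sigma(y)$ for $t>0$, with $\mathcal{R}(f)(x,0)=f(x)$. For each $m\ge 0$, $\{Y^m_l\}_{l=1}^{l_m}$ is a fixed orthonormal basis of the space of spherical harmonics of degree $m$ on the unit sphere $\mathbb{S}^{n-1}$, and $l_m$ is the dimension of that space. Thus $r^m f_{ml}(r)$ and $r^m g_{ml}(r,t)$ are the coefficients of $\theta\mapsto f(r\theta)$ and $\theta\mapsto G(r\theta,t)$ with respect to $Y^m_l$ for $r>0$. Since $f$ and $G(\cdot,t)$ are smooth, $f_{ml}(r)$ and $g_{ml}(r,t)$ extend continuously (indeed smoothly) to $r=0$, and $g_{ml}(0,t)$ denotes the value of this extension at $r=0$. *)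

theory Defs
  imports "HOL-Analysis.Analysis"
begin

subsection \<open>Smooth functions\<close>

primrec C_k :: "nat \<Rightarrow> ('a::euclidean_space \<Rightarrow> 'b::real_normed_vector) \<Rightarrow> bool" where
  "C_k 0 f \<longleftrightarrow> continuous_on UNIV f"
| "C_k (Suc k) f \<longleftrightarrow>
     (\<exists>D. (\<forall>x. (f has_derivative D x) (at x)) \<and> (\<forall>b\<in>Basis. C_k k (\<lambda>x. D x b)))"

definition C_infinity :: "('a::euclidean_space \<Rightarrow> 'b::real_normed_vector) \<Rightarrow> bool" where
  "C_infinity f \<longleftrightarrow> (\<forall>k. C_k k f)"

subsection \<open>Surface measure on spheres and the spherical mean transform\<close>

text \<open>
  Surface measure in polar-coordinate form: the cone with apex \<open>x\<close> over a Borel subset \<open>E\<close>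
  of the sphere \<open>S(x,t)\<close> has Lebesgue measure \<open>(t / n) \<sigma>(E)\<close>. So \<open>\<sigma>\<close> is \<open>n / t\<close> times the
  image of Lebesgue measure on the punctured ball under radial projection onto the sphere;
  see \<open>emeasure_sphere_measure\<close> below. Only \<open>t > 0\<close> is meaningful.
\<close>

definition sphere_measure :: "'a::euclidean_space \<Rightarrow> real \<Rightarrow> 'a measure" where
  "sphere_measure x t =
     scale_measure (ennreal (real DIM('a) / t))
       (distr (restrict_space lborel (cball x t - {x}))
              (restrict_space borel (sphere x t))
              (\<lambda>y. x + (t / dist x y) *\<^sub>R (y - x)))"

lemma space_sphere_measure [simp]: "space (sphere_measure x t) = sphere x t"
  by (simp add: sphere_measure_def space_scale_measure space_restrict_space)

lemma sets_sphere_measure: "sets (sphere_measure x t) = sets (restrict_space borel (sphere x t))"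
  by (simp add: sphere_measure_def)

lemma emeasure_sphere_measure:
  fixes x :: "'a::euclidean_space"
  assumes t: "0 < t" and E: "E \<in> sets borel" "E \<subseteq> sphere x t"
  shows "emeasure (sphere_measure x t) E =
    ennreal (real DIM('a) / t) * emeasure lborel {x + s *\<^sub>R (y - x) | s y. 0 < s \<and> s \<le> 1 \<and> y \<in> E}"
proof -
  let ?p = "\<lambda>y. x + (t / dist x y) *\<^sub>R (y - x)"
  let ?B = "restrict_space lborel (cball x t - {x})"
  have 1: "continuous_on (cball x t - {x}) ?p"
    by (intro continuous_intros) auto
  have meas: "?p \<in> measurable ?B (restrict_space borel (sphere x t))"
  proof (rule measurable_restrict_space2)
    show "?p \<in> space ?B \<rightarrow> sphere x t"
      using t by (auto simp: space_restrict_space dist_norm norm_minus_commute)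
    have "?p \<in> borel_measurable (restrict_space borel (cball x t - {x}))"
      using 1 by (rule borel_measurable_continuous_on_restrict)
    moreover have "sets ?B = sets (restrict_space borel (cball x t - {x}))"
      by (simp add: sets_restrict_space)
    ultimately show "?p \<in> borel_measurable ?B"
      using measurable_cong_sets by blast
  qed
  have Es: "E \<in> sets (restrict_space borel (sphere x t))"
    using E by (auto simp: sets_restrict_space)
  have cone: "?p -` E \<inter> (cball x t - {x}) = {x + s *\<^sub>R (y - x) | s y. 0 < s \<and> s \<le> 1 \<and> y \<in> E}"
    (is "?L = ?R")
  proof (intro equalityI subsetI)
    fix z assume z: "z \<in> ?L"
    then have d: "dist x z > 0" "dist x z \<le> t" by auto
    have "z = x + (dist x z / t) *\<^sub>R (?p z - x)" using d less_imp_neq[OF t] by simp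
    moreover have "0 < dist x z / t" "dist x z / t \<le> 1" using d t by (simp_all add: divide_simps)
    ultimately show "z \<in> ?R" using z by blast
  next
    fix z assume "z \<in> ?R"
    then obtain s y where z: "z = x + s *\<^sub>R (y - x)" "0 < s" "s \<le> 1" "y \<in> E" by blast
    have n: "norm (y - x) = t" using z(4) E(2) by (auto simp: dist_norm norm_minus_commute)
    then have d: "dist x z = s * t" using z by (simp add: dist_norm)
    have "?p z = y" using z t d by simp
    moreover have "s * t \<le> t" using z t by (simp add: mult_left_le_one_le)
    moreover have "z \<noteq> x" using d z(2) t by auto
    ultimately show "z \<in> ?L" using d z less_imp_neq[OF t] by simp
  qed
  have "emeasure (sphere_measure x t) E = ennreal (real DIM('a) / t) * emeasure ?B ?L"
    by (simp add: sphere_measure_def emeasure_distr[OF meas Es] space_restrict_space)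
  also have "emeasure ?B ?L = emeasure lborel ?L"
    by (rule emeasure_restrict_space) auto
  finally show ?thesis using cone by simp
qed

definition spherical_mean :: "('a::euclidean_space \<Rightarrow> complex) \<Rightarrow> 'a \<Rightarrow> real \<Rightarrow> complex" where
  "spherical_mean f x t =
     (if t = 0 then f x
      else (LINT y|sphere_measure x t. f y) / of_real (measure (sphere_measure x t) (sphere x t)))"

subsection \<open>Spherical harmonics\<close>

definition homogeneous_polynomial :: "nat \<Rightarrow> (real ^ 'n \<Rightarrow> complex) \<Rightarrow> bool" where
  "homogeneous_polynomial m P \<longleftrightarrow>
     (\<exists>c. \<forall>x. P x =
        (\<Sum>\<alpha> | (\<Sum>i\<in>UNIV. \<alpha> i) = m. c \<alpha> * (\<Prod>i\<in>UNIV. of_real (x $ i) ^ \<alpha> i)))"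

lemma finite_multi_indices: "finite {\<alpha> :: 'n::finite \<Rightarrow> nat. (\<Sum>i\<in>UNIV. \<alpha> i) = m}"
proof (rule finite_subset)
  show "{\<alpha> :: 'n \<Rightarrow> nat. (\<Sum>i\<in>UNIV. \<alpha> i) = m} \<subseteq> (UNIV \<rightarrow>\<^sub>E {..m})"
    by (auto simp: PiE_def extensional_def intro: member_le_sum)
  show "finite ((UNIV :: 'n set) \<rightarrow>\<^sub>E {..m})"
    by (intro finite_PiE) auto
qed

definition partial_derivative :: "'n \<Rightarrow> (real ^ 'n \<Rightarrow> complex) \<Rightarrow> real ^ 'n \<Rightarrow> complex" where
  "partial_derivative i f x = vector_derivative (\<lambda>s. f (x + s *\<^sub>R axis i 1)) (at 0)"

definition laplacian :: "(real ^ 'n \<Rightarrow> complex) \<Rightarrow> real ^ 'n \<Rightarrow> complex" where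
  "laplacian f x = (\<Sum>i\<in>UNIV. partial_derivative i (partial_derivative i f) x)"

text \<open>Functions on the unit sphere are represented by functions on the whole space of which
  only the values on the sphere matter.\<close>

definition spherical_harmonic :: "nat \<Rightarrow> (real ^ 'n \<Rightarrow> complex) \<Rightarrow> bool" where
  "spherical_harmonic m H \<longleftrightarrow>
     (\<exists>P. homogeneous_polynomial m P \<and> (\<forall>x. laplacian P x = 0) \<and>
          (\<forall>\<theta>\<in>sphere 0 1. H \<theta> = P \<theta>))"

definition sphere_inner :: "(real ^ 'n \<Rightarrow> complex) \<Rightarrow> (real ^ 'n \<Rightarrow> complex) \<Rightarrow> complex" where
  "sphere_inner u v = (LINT \<theta>|sphere_measure 0 1. u \<theta> * cnj (v \<theta>))"

text \<open>\<open>Y 1, \<dots>, Y d\<close> is an orthonormal basis of the space of spherical harmonics of degree \<open>m\<close>;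
  in particular \<open>d\<close> is the dimension of that space.\<close>

definition orthonormal_basis_harmonics ::
    "nat \<Rightarrow> nat \<Rightarrow> (nat \<Rightarrow> real ^ 'n \<Rightarrow> complex) \<Rightarrow> bool" where
  "orthonormal_basis_harmonics m d Y \<longleftrightarrow>
     (\<forall>l\<in>{1..d}. spherical_harmonic m (Y l)) \<and>
     (\<forall>l\<in>{1..d}. \<forall>l'\<in>{1..d}. sphere_inner (Y l) (Y l') = (if l = l' then 1 else 0)) \<and>
     (\<forall>H. spherical_harmonic m H \<longrightarrow>
        (\<exists>c. \<forall>\<theta>\<in>sphere 0 1. H \<theta> = (\<Sum>l=1..d. c l * Y l \<theta>)))"

subsection \<open>Expansion coefficients\<close>

text \<open>For \<open>r > 0\<close>, \<open>r ^ m * harmonic_coeff m H u r\<close> is the coefficient of \<open>\<theta> \<mapsto> u (r \<theta>)\<close> with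
  respect to the degree-\<open>m\<close> basis element \<open>H\<close>; the value at \<open>r = 0\<close> is the continuous extension.\<close>

definition harmonic_coeff ::
    "nat \<Rightarrow> (real ^ 'n \<Rightarrow> complex) \<Rightarrow> (real ^ 'n \<Rightarrow> complex) \<Rightarrow> real \<Rightarrow> complex" where
  "harmonic_coeff m H u r =
     (let h = (\<lambda>\<rho>. sphere_inner (\<lambda>\<theta>. u (\<rho> *\<^sub>R \<theta>)) H / of_real (\<rho> ^ m))
      in if r = 0 then Lim (at_right 0) h else h r)"

text \<open>\<open>k_coeff n a m g\<close> is the function \<open>k\<^sub>m\<^sub>l\<close> built from \<open>g \<tau> = g\<^sub>m\<^sub>l(0,\<tau>)\<close> in dimension \<open>n\<close>.
  The integral is oriented, so it changes sign when \<open>r < a\<close>.\<close>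

definition k_coeff :: "nat \<Rightarrow> real \<Rightarrow> nat \<Rightarrow> (real \<Rightarrow> complex) \<Rightarrow> real \<Rightarrow> complex" where
  "k_coeff n a m g r =
     (if m = 0 then g r
      else of_real ((\<Prod>j<m. real (n + 2 * j)) / (2 ^ (m - 1) * fact (m - 1))
                    * r powi (- int (n + 2 * (m - 1))))
           * (LBINT \<tau>=a..r. g \<tau> * of_real (\<tau> ^ (n - 1) * (r\<^sup>2 - \<tau>\<^sup>2) ^ (m - 1))))"

end

theory Submission
  imports Defs
begin

text \<open>
  Let \<open>Q\<close> be the complex conjugate of the solid harmonic extending \<open>Y m l\<close>, and for a function
  \<open>u\<close> put \<open>M u r = r ^ (n - 2) * \<integral> u (r \<theta>) d\<sigma>(\<theta>)\<close>, so that the coefficient of \<open>u\<close> is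
  \<open>M (Q u) r / r ^ (n - 2 + 2 m)\<close>. With \<open>D = (1 / r) d/dr\<close>, the divergence theorem for balls says
  \<open>D (M (x\<^sub>i u)) = M (\<partial>\<^sub>i u)\<close>. By Euler's identity \<open>m Q = \<Sum> x\<^sub>i \<partial>\<^sub>i Q\<close> and harmonicity of \<open>Q\<close> this gives
  \<open>D (M (Q u)) = (1 / m) \<Sum> M (\<partial>\<^sub>i Q \<partial>\<^sub>i u)\<close>, and after \<open>m\<close> steps
  \<open>D ^ m (M (Q u)) = M (E u)\<close>, where \<open>E\<close> is the constant coefficient differential operator \<open>Q(\<partial>)\<close>.

  Applied to \<open>u = G(\<cdot>, t)\<close>, L'Hopital's rule identifies the value of the coefficient at \<open>r = 0\<close> as a
  multiple of \<open>(E G)(0, t)\<close>; as \<open>E\<close> commutes with spherical means, this is a multiple of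
  \<open>\<integral> (E f) (t \<theta>) d\<sigma>(\<theta>)\<close>. Applied to \<open>u = f\<close>, integrating \<open>D ^ m\<close> from \<open>a\<close> recovers \<open>M (Q f)\<close> from
  these integrals up to a polynomial of degree less than \<open>m\<close> in \<open>r\<^sup>2\<close>.
\<close>

subsection \<open>Integration over spheres\<close>

lemma scale_measure_eq_density: "scale_measure c M = density M (\<lambda>_. c)"
  by (rule measure_eqI) (simp_all add: emeasure_density_const)

lemma lborel_integral_affine:
  fixes g :: "'a::euclidean_space \<Rightarrow> 'b::{banach, second_countable_topology}"
  assumes [measurable]: "g \<in> borel_measurable borel" and c: "c > 0"
  shows "(LINT y|lborel. g y) = c ^ DIM('a) *\<^sub>R (LINT z|lborel. g (x + c *\<^sub>R z))"
proof -
  have "(LINT y|lborel. g y) =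
      (LINT y|density (distr lborel borel (\<lambda>z. x + c *\<^sub>R z)) (\<lambda>_. \<bar>c\<bar> ^ DIM('a)). g y)"
    using lborel_affine[of c x] c by simp
  also have "\<dots> = (LINT y|distr lborel borel (\<lambda>z. x + c *\<^sub>R z). \<bar>c\<bar> ^ DIM('a) *\<^sub>R g y)"
    by (rule integral_density) auto
  also have "\<dots> = (LINT z|lborel. \<bar>c\<bar> ^ DIM('a) *\<^sub>R g (x + c *\<^sub>R z))"
    by (rule integral_distr) auto
  finally show ?thesis using c by simp
qed

lemma radial_projection_continuous_on:
  fixes x :: "'a::euclidean_space"
  shows "continuous_on (UNIV - {x}) (\<lambda>y. x + (t / dist x y) *\<^sub>R (y - x))"
  by (intro continuous_intros) auto

lemma radial_projection_in_sphere:
  fixes x :: "'a::euclidean_space"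
  shows "t > 0 \<Longrightarrow> y \<noteq> x \<Longrightarrow> x + (t / dist x y) *\<^sub>R (y - x) \<in> sphere x t"
  by (simp add: dist_norm norm_minus_commute)

text \<open>The centre has to be removed: the radial projection is continuous only on the punctured
  ball.\<close>

lemma radial_integrand_measurable:
  fixes x :: "'a::euclidean_space" and h :: "'a \<Rightarrow> 'b::{banach, second_countable_topology}"
  assumes t: "t > 0" and h: "continuous_on (sphere x t) h"
  shows "(\<lambda>y. indicator (cball x R - {x}) y *\<^sub>R h (x + (t / dist x y) *\<^sub>R (y - x)))
    \<in> borel_measurable borel"
proof (rule borel_measurable_continuous_on_indicator)
  have "continuous_on (UNIV - {x}) (h \<circ> (\<lambda>y. x + (t / dist x y) *\<^sub>R (y - x)))"
    by (intro continuous_on_compose radial_projection_continuous_on continuous_on_subset[OF h]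
        image_subsetI radial_projection_in_sphere[OF t]) auto
  then show "continuous_on (cball x R - {x}) (\<lambda>y. h (x + (t / dist x y) *\<^sub>R (y - x)))"
    unfolding o_def by (rule continuous_on_subset) auto
qed auto

lemma integral_sphere_measure:
  fixes h :: "'a::euclidean_space \<Rightarrow> 'b::{banach, second_countable_topology}"
  assumes t: "t > 0" and h: "continuous_on (sphere x t) h"
  shows "(LINT y|sphere_measure x t. h y) = (real DIM('a) / t) *\<^sub>R
    (LINT y|lborel. indicator (cball x t - {x}) y *\<^sub>R h (x + (t / dist x y) *\<^sub>R (y - x)))"
proof -
  let ?p = "\<lambda>y. x + (t / dist x y) *\<^sub>R (y - x)"
  let ?B = "restrict_space lborel (cball x t - {x})"
  have "?p \<in> borel_measurable (restrict_space borel (cball x t - {x}))"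
    by (rule borel_measurable_continuous_on_restrict)
      (rule continuous_on_subset[OF radial_projection_continuous_on], auto)
  moreover have "sets ?B = sets (restrict_space borel (cball x t - {x}))"
    by (simp add: sets_restrict_space)
  ultimately have "?p \<in> borel_measurable ?B"
    using measurable_cong_sets by blast
  then have p: "?p \<in> measurable ?B (restrict_space borel (sphere x t))"
    using t by (intro measurable_restrict_space2)
      (auto simp: space_restrict_space dist_norm norm_minus_commute)
  have h': "h \<in> borel_measurable (restrict_space borel (sphere x t))"
    by (rule borel_measurable_continuous_on_restrict[OF h])
  have "(LINT y|sphere_measure x t. h y) =
      (LINT y|distr ?B (restrict_space borel (sphere x t)) ?p. (real DIM('a) / t) *\<^sub>R h y)"
    unfolding sphere_measure_def scale_measure_eq_density
    by (rule integral_density) (use h' t in auto)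
  also have "\<dots> = (LINT y|?B. (real DIM('a) / t) *\<^sub>R h (?p y))"
    by (rule integral_distr) (use p h' in auto)
  also have "\<dots> = (real DIM('a) / t) *\<^sub>R (LINT y|?B. h (?p y))"
    by simp
  also have "(LINT y|?B. h (?p y)) = (LINT y|lborel. indicator (cball x t - {x}) y *\<^sub>R h (?p y))"
    by (rule integral_restrict_space) auto
  finally show ?thesis .
qed

text \<open>The integrand is constant along rays from \<open>x\<close>, so rescaling the ball of
  radius \<open>R\<close> to the unit ball produces only the volume factor. The radius
  \<open>t\<close> selects the sphere being sampled and is independent of \<open>R\<close>; this
  freedom is what allows \<open>R\<close> to vary in the polar coordinate argument.\<close>

lemma integral_ball_radial:
  fixes h :: "'a::euclidean_space \<Rightarrow> 'b::{banach, second_countable_topology}"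
  assumes t: "t > 0" and R: "R > 0" and h: "continuous_on (sphere x t) h"
  shows "(LINT y|lborel. indicator (cball x R - {x}) y *\<^sub>R h (x + (t / dist x y) *\<^sub>R (y - x))) =
    (R ^ DIM('a) / DIM('a)) *\<^sub>R (LINT \<theta>|sphere_measure 0 1. h (x + t *\<^sub>R \<theta>))"
proof -
  have h': "continuous_on (sphere 0 1) (\<lambda>\<theta>. h (x + t *\<^sub>R \<theta>))"
    by (rule continuous_on_compose2[OF h])
      (use t in \<open>auto intro!: continuous_intros simp: dist_norm\<close>)
  have "(LINT y|lborel. indicator (cball x R - {x}) y *\<^sub>R h (x + (t / dist x y) *\<^sub>R (y - x))) =
     R ^ DIM('a) *\<^sub>R (LINT z|lborel. indicator (cball x R - {x}) (x + R *\<^sub>R z) *\<^sub>R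
       h (x + (t / dist x (x + R *\<^sub>R z)) *\<^sub>R (x + R *\<^sub>R z - x)))"
    by (rule lborel_integral_affine[OF radial_integrand_measurable[OF t h] R])
  also have "(\<lambda>z. indicator (cball x R - {x}) (x + R *\<^sub>R z) *\<^sub>R
       h (x + (t / dist x (x + R *\<^sub>R z)) *\<^sub>R (x + R *\<^sub>R z - x))) =
     (\<lambda>z. indicator (cball 0 1 - {0}) z *\<^sub>R h (x + t *\<^sub>R (0 + (1 / dist 0 z) *\<^sub>R (z - 0))))"
    using R by (auto simp: fun_eq_iff indicator_def dist_norm)
  also have "R ^ DIM('a) *\<^sub>R (LINT z|lborel. \<dots> z) =
      (R ^ DIM('a) / DIM('a)) *\<^sub>R (LINT \<theta>|sphere_measure 0 1. h (x + t *\<^sub>R \<theta>))"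
    by (subst integral_sphere_measure[OF _ h']) simp_all
  finally show ?thesis .
qed

lemma integral_sphere_measure_unit:
  fixes h :: "'a::euclidean_space \<Rightarrow> 'b::{banach, second_countable_topology}"
  assumes t: "t > 0" and h: "continuous_on (sphere x t) h"
  shows "(LINT y|sphere_measure x t. h y) =
    t ^ (DIM('a) - 1) *\<^sub>R (LINT \<theta>|sphere_measure 0 1. h (x + t *\<^sub>R \<theta>))"
proof -
  have "t ^ DIM('a) = t * t ^ (DIM('a) - 1)"
    by (metis DIM_positive power_minus_mult mult.commute)
  then show ?thesis
    using t by (simp add: integral_sphere_measure[OF t h] integral_ball_radial[OF t t h])
qed

definition sphere_area :: "'a::euclidean_space itself \<Rightarrow> real" where
  "sphere_area _ = measure (sphere_measure (0::'a) 1) (sphere 0 1)"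

text \<open>The measure of the sphere is the dimension times the volume of the cone over it, and
  this cone lies in the unit ball.\<close>

lemma finite_measure_sphere: "finite_measure (sphere_measure (0::'a::euclidean_space) 1)"
proof
  have "emeasure (sphere_measure (0::'a) 1) (sphere 0 1) = ennreal DIM('a) *
     emeasure lborel {0 + s *\<^sub>R (y - 0) | s y. 0 < s \<and> s \<le> (1::real) \<and> y \<in> sphere (0::'a) 1}"
    by (subst emeasure_sphere_measure) auto
  also have "\<dots> \<le> ennreal DIM('a) * emeasure lborel (cball (0::'a) 1)"
    by (intro mult_left_mono emeasure_mono) auto
  also have "\<dots> < \<infinity>"
    using emeasure_lborel_cball_finite[of "0::'a" 1] by (simp add: ennreal_mult_less_top)
  finally show "emeasure (sphere_measure (0::'a) 1) (space (sphere_measure (0::'a) 1)) \<noteq> \<infinity>"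
    by simp
qed

lemma integral_ball_one: "R > 0 \<Longrightarrow>
   (LINT y|lborel. indicator (cball (0::'a::euclidean_space) R - {0}) y) =
     R ^ DIM('a) / DIM('a) * sphere_area TYPE('a)"
  using integral_ball_radial[of 1 R "0::'a" "\<lambda>_. 1::real"]
  by (simp add: sphere_area_def)

lemma sphere_area_pos: "sphere_area TYPE('a::euclidean_space) > 0"
proof -
  have "(LINT y|lborel. indicator (cball (0::'a) 1 - {0}) y) = measure lborel (cball (0::'a) 1 - {0})"
    by simp
  also have "\<dots> = measure lborel (cball (0::'a) 1)"
    by (rule measure_Diff_null_set) auto
  also have "\<dots> > 0"
    using content_cball_pos[of 1 "0::'a"] by (simp add: measure_completion)
  finally show ?thesis
    using integral_ball_one[of 1, where 'a='a] by (simp add: zero_less_divide_iff)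
qed

lemma sphere_integrable:
  fixes h :: "'a::euclidean_space \<Rightarrow> 'b::{banach, second_countable_topology}"
  assumes h: "continuous_on (sphere 0 1) h"
  shows "integrable (sphere_measure 0 1) h"
proof -
  interpret finite_measure "sphere_measure (0::'a) 1" by (rule finite_measure_sphere)
  obtain B where "\<And>x. x \<in> sphere 0 1 \<Longrightarrow> norm (h x) \<le> B"
    using compact_imp_bounded[OF compact_continuous_image[OF h compact_sphere]]
    unfolding bounded_iff by blast
  then show ?thesis
    using borel_measurable_continuous_on_restrict[OF h]
    by (intro integrable_const_bound[where B=B] AE_I2)
      (simp_all add: measurable_cong_sets[OF sets_sphere_measure refl])
qed

lemma sphere_integral_norm_le:
  fixes h :: "'a::euclidean_space \<Rightarrow> 'b::{banach, second_countable_topology}"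
  assumes h: "continuous_on (sphere 0 1) h" and B: "\<And>\<theta>. norm \<theta> = 1 \<Longrightarrow> norm (h \<theta>) \<le> B"
  shows "norm (LINT \<theta>|sphere_measure 0 1. h \<theta>) \<le> sphere_area TYPE('a) * B"
proof -
  interpret finite_measure "sphere_measure (0::'a) 1" by (rule finite_measure_sphere)
  have "norm (LINT \<theta>|sphere_measure 0 1. h \<theta>) \<le> (LINT \<theta>|sphere_measure (0::'a) 1. B)"
    by (rule order_trans[OF integral_norm_bound integral_mono])
      (use sphere_integrable[OF h] B in auto)
  then show ?thesis by (simp add: sphere_area_def)
qed

text \<open>Moves every mean to one fixed measure, so that \<open>x\<close> and \<open>t\<close>
  occur only inside the integrand and differentiation under the integral becomes possible.\<close>

lemma spherical_mean_eq:
  assumes t: "t > 0" and f: "continuous_on UNIV f"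
  shows "spherical_mean f (x::'a::euclidean_space) t =
    (LINT \<theta>|sphere_measure 0 1. f (x + t *\<^sub>R \<theta>)) / of_real (sphere_area TYPE('a))"
proof -
  have "measure (sphere_measure x t) (sphere x t) = t ^ (DIM('a) - 1) * sphere_area TYPE('a)"
    using integral_sphere_measure_unit[OF t, of x "\<lambda>_. 1::real"] by (simp add: sphere_area_def)
  then show ?thesis
    using t integral_sphere_measure_unit[OF t continuous_on_subset[OF f], of x]
    by (simp add: spherical_mean_def scaleR_conv_of_real)
qed

subsection \<open>Polar coordinates\<close>

definition ball_integral :: "('a::euclidean_space \<Rightarrow> 'b::{banach, second_countable_topology}) \<Rightarrow> real \<Rightarrow> 'b" where
  "ball_integral F R = (LINT x|lborel. indicator (cball 0 R) x *\<^sub>R F x)"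

lemma ball_integrable:
  fixes F :: "'a::euclidean_space \<Rightarrow> 'b::{banach, second_countable_topology}"
  assumes "continuous_on UNIV F"
  shows "integrable lborel (\<lambda>x. indicator (cball 0 R) x *\<^sub>R F x)"
  by (rule borel_integrable_compact) (use assms continuous_on_subset in auto)

lemma AE_lborel_neq: "AE x in lborel. x \<noteq> (c::'a::euclidean_space)"
  by (rule AE_I'[of "{c}"]) auto

text \<open>\<open>F\<close> is compared with the function that extends its values on the sphere of
  radius \<open>R\<close> constantly along rays. The integral of that extension over any ball is
  known from \<open>integral_ball_radial\<close>, while the difference is small near the
  sphere.\<close>

lemma ball_integral_minus_homogeneous:
  fixes F :: "'a::euclidean_space \<Rightarrow> 'b::{banach, second_countable_topology}"
  assumes F: "continuous_on UNIV F" and S: "S > 0" and R: "R > 0"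
  defines "g \<equiv> \<lambda>S x. indicator (cball 0 S - {0}) x *\<^sub>R (F x - F ((R / norm x) *\<^sub>R x))"
  shows "integrable lborel (g S)"
    and "(LINT x|lborel. g S x) = ball_integral F S -
      (S ^ DIM('a) / DIM('a)) *\<^sub>R (LINT \<theta>|sphere_measure 0 1. F (R *\<^sub>R \<theta>))"
proof -
  have Fs: "continuous_on (sphere 0 R) F"
    using F continuous_on_subset by blast
  let ?h = "\<lambda>x. indicator (cball 0 S - {0}) x *\<^sub>R F (0 + (R / dist 0 x) *\<^sub>R (x - 0))"
  let ?F = "\<lambda>x. indicator (cball 0 S) x *\<^sub>R F x"
  have meas: "?h \<in> borel_measurable borel"
    by (rule radial_integrand_measurable[OF R Fs])
  obtain B where B: "\<And>y. y \<in> sphere 0 R \<Longrightarrow> norm (F y) \<le> B"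
    using compact_imp_bounded[OF compact_continuous_image[OF Fs compact_sphere]]
    unfolding bounded_iff by blast
  have int_h: "integrable lborel ?h"
  proof (rule Bochner_Integration.integrable_bound)
    show "integrable lborel (\<lambda>x::'a. indicator (cball 0 S) x *\<^sub>R B)"
      by (rule ball_integrable) auto
    show "AE x in lborel. norm (?h x) \<le> norm (indicator (cball 0 S) x *\<^sub>R B)"
    proof (rule AE_I2)
      fix x :: 'a
      show "norm (?h x) \<le> norm (indicator (cball 0 S) x *\<^sub>R B)"
        using B[of "(R / norm x) *\<^sub>R x"] R
        by (cases "x = 0") (auto simp: indicator_def abs_of_nonneg intro: order_trans)
    qed
  qed (use meas in simp)
  have int_F: "integrable lborel ?F"
    by (rule ball_integrable[OF F])
  \<comment> \<open>The two integrable functions \<open>?F\<close> and \<open>?h\<close> give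
    \<open>g S\<close> everywhere except at the origin, where \<open>g S\<close> is zero; a case
    distinction repairs that single point.\<close>
  have gm: "g S \<in> borel_measurable lborel"
  proof -
    have "g S = (\<lambda>x. (if x = 0 then 0 else ?F x) - ?h x)"
      by (auto simp: g_def fun_eq_iff indicator_def scaleR_diff_right)
    moreover have "(\<lambda>x. (if x = 0 then 0 else ?F x)) \<in> borel_measurable lborel"
      using int_F by (intro measurable_If) auto
    ultimately show ?thesis using int_h by auto
  qed
  have ae: "AE x in lborel. g S x = ?F x - ?h x"
    using AE_lborel_neq[of "0::'a"]
    by eventually_elim (auto simp: g_def indicator_def scaleR_diff_right)
  have int_d: "integrable lborel (\<lambda>x. ?F x - ?h x)"
    using int_F int_h by (rule Bochner_Integration.integrable_diff)
  show "integrable lborel (g S)"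
    by (rule Bochner_Integration.integrable_bound[OF int_d gm])
      (use ae in \<open>auto elim: eventually_mono\<close>)
  have "(LINT x|lborel. g S x) = (LINT x|lborel. ?F x - ?h x)"
    by (rule integral_cong_AE[OF gm _ ae]) (use int_d in auto)
  also have "\<dots> = (LINT x|lborel. ?F x) - (LINT x|lborel. ?h x)"
    by (rule Bochner_Integration.integral_diff[OF int_F int_h])
  also have "(LINT x|lborel. ?h x) =
      (S ^ DIM('a) / DIM('a)) *\<^sub>R (LINT \<theta>|sphere_measure 0 1. F (0 + R *\<^sub>R \<theta>))"
    by (rule integral_ball_radial[OF R S Fs])
  finally show "(LINT x|lborel. g S x) = ball_integral F S -
      (S ^ DIM('a) / DIM('a)) *\<^sub>R (LINT \<theta>|sphere_measure 0 1. F (R *\<^sub>R \<theta>))"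
    by (simp add: ball_integral_def)
qed

text \<open>The increment of \<open>e\<close> is an integral over the annulus between the two radii,
  where the integrand is at most \<open>\<epsilon>\<close>; the last factor is the volume of this
  annulus.\<close>

lemma annulus_integral_bound:
  fixes F :: "'a::euclidean_space \<Rightarrow> 'b::{banach, second_countable_topology}"
  assumes F: "continuous_on UNIV F" and R: "R > 0" and S: "0 < S1" "S1 \<le> S2"
    and eps: "\<And>x. S1 \<le> norm x \<Longrightarrow> norm x \<le> S2 \<Longrightarrow> norm (F x - F ((R / norm x) *\<^sub>R x)) \<le> \<epsilon>"
  defines "e \<equiv> \<lambda>S. ball_integral F S -
      (S ^ DIM('a) / DIM('a)) *\<^sub>R (LINT \<theta>|sphere_measure 0 1. F (R *\<^sub>R \<theta>))"
  shows "norm (e S2 - e S1) \<le> \<epsilon> * (sphere_area TYPE('a) / DIM('a) * (S2 ^ DIM('a) - S1 ^ DIM('a)))"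
proof -
  define g where "g S x = indicator (cball 0 S - {0}) x *\<^sub>R (F x - F ((R / norm x) *\<^sub>R x))" for S x
  let ?i = "\<lambda>S. indicator (cball (0::'a) S - {0}) :: 'a \<Rightarrow> real"
  have S2: "S2 > 0" using S by simp
  have int_i: "integrable lborel (?i S)" for S
  proof (rule Bochner_Integration.integrable_bound[OF ball_integrable[of "\<lambda>_. 1::real" S]])
    show "?i S \<in> borel_measurable lborel"
      by (intro borel_measurable_indicator) auto
  qed (auto simp: indicator_def)
  have g: "integrable lborel (g S)" "(LINT x|lborel. g S x) = e S" if "S > 0" for S
    using ball_integral_minus_homogeneous[OF F that R] by (simp_all add: g_def[abs_def] e_def)
  have "norm (e S2 - e S1) = norm (LINT x|lborel. g S2 x - g S1 x)"
    using g[OF S2] g[OF S(1)] by simp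
  also have "\<dots> \<le> (LINT x|lborel. norm (g S2 x - g S1 x))"
    by (rule integral_norm_bound)
  also have "\<dots> \<le> (LINT x|lborel. \<epsilon> * (?i S2 x - ?i S1 x))"
  proof (rule integral_mono)
    fix x :: 'a
    show "norm (g S2 x - g S1 x) \<le> \<epsilon> * (?i S2 x - ?i S1 x)"
      using S eps[of x] by (auto simp: g_def indicator_def)
  qed (use g[OF S2] g[OF S(1)] int_i in auto)
  also have "\<dots> = \<epsilon> * ((LINT x|lborel. ?i S2 x) - (LINT x|lborel. ?i S1 x))"
    using int_i by (subst integral_mult_right_zero, subst Bochner_Integration.integral_diff) auto
  also have "\<dots> = \<epsilon> * (sphere_area TYPE('a) / DIM('a) * (S2 ^ DIM('a) - S1 ^ DIM('a)))"
    by (subst integral_ball_one[OF S2], subst integral_ball_one[OF S(1)]) (simp add: field_simps)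
  finally show ?thesis .
qed

text \<open>Increments of \<open>e\<close> are negligible against those of \<open>\<phi>\<close>,
  and a differentiable \<open>\<phi>\<close> has increments of at most linear size.\<close>

lemma has_vector_derivative_zero_comparison:
  fixes e :: "real \<Rightarrow> 'b::real_normed_vector" and \<phi> :: "real \<Rightarrow> real"
  assumes \<phi>: "(\<phi> has_real_derivative c) (at R)"
    and small: "\<And>\<epsilon>. \<epsilon> > 0 \<Longrightarrow> \<exists>d>0. \<forall>S. \<bar>S - R\<bar> < d \<longrightarrow> norm (e S - e R) \<le> \<epsilon> * \<bar>\<phi> S - \<phi> R\<bar>"
  shows "(e has_vector_derivative 0) (at R)"
  unfolding has_vector_derivative_def has_derivative_at_alt
proof (intro conjI allI impI)
  fix \<eta> :: real assume \<eta>: "0 < \<eta>"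
  \<comment> \<open>Tolerance 1 in the definition of the derivative makes \<open>\<phi>\<close>
    Lipschitz at \<open>R\<close> with constant \<open>\<bar>c\<bar> + 1\<close>, which is also
    positive and so may be divided by.\<close>
  obtain d1 where d1: "d1 > 0" "\<And>S. \<bar>S - R\<bar> < d1 \<Longrightarrow> \<bar>\<phi> S - \<phi> R - c * (S - R)\<bar> \<le> \<bar>S - R\<bar>"
    using \<phi> unfolding has_field_derivative_def has_derivative_at_alt
    by (metis real_norm_def mult_1 zero_less_one)
  obtain d2 where d2: "d2 > 0"
    "\<And>S. \<bar>S - R\<bar> < d2 \<Longrightarrow> norm (e S - e R) \<le> \<eta> / (\<bar>c\<bar> + 1) * \<bar>\<phi> S - \<phi> R\<bar>"
    using small[of "\<eta> / (\<bar>c\<bar> + 1)"] \<eta> by (auto simp: add_nonneg_pos)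
  show "\<exists>d>0. \<forall>y. norm (y - R) < d \<longrightarrow> norm (e y - e R - (y - R) *\<^sub>R 0) \<le> \<eta> * norm (y - R)"
  proof (intro exI[of _ "min d1 d2"] conjI allI impI)
    fix y assume y: "norm (y - R) < min d1 d2"
    have "\<bar>\<phi> y - \<phi> R\<bar> \<le> \<bar>\<phi> y - \<phi> R - c * (y - R)\<bar> + \<bar>c * (y - R)\<bar>"
      by linarith
    also have "\<dots> \<le> (\<bar>c\<bar> + 1) * \<bar>y - R\<bar>"
      using d1(2)[of y] y unfolding abs_mult distrib_right by simp
    finally have "\<eta> / (\<bar>c\<bar> + 1) * \<bar>\<phi> y - \<phi> R\<bar> \<le> \<eta> / (\<bar>c\<bar> + 1) * ((\<bar>c\<bar> + 1) * \<bar>y - R\<bar>)"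
      using \<eta> by (intro mult_left_mono) auto
    also have "\<dots> = \<eta> * \<bar>y - R\<bar>"
      by (simp add: field_simps add_pos_nonneg)
    finally show "norm (e y - e R - (y - R) *\<^sub>R 0) \<le> \<eta> * norm (y - R)"
      using d2(2)[of y] y by simp
  qed (use d1 d2 in auto)
qed simp

text \<open>Polar coordinates in differentiated form. Subtracting from the ball integral the volume
  term \<open>S ^ n / n\<close> times the sphere integral at the fixed radius \<open>R\<close>
  leaves a remainder \<open>e\<close> with derivative zero at \<open>R\<close>, because
  \<open>F\<close> varies little across a thin annulus.\<close>

theorem ball_integral_has_vector_derivative:
  fixes F :: "'a::euclidean_space \<Rightarrow> 'b::{banach, second_countable_topology}"
  assumes F: "continuous_on UNIV F" and R: "R > 0"
  shows "(ball_integral F has_vector_derivative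
    R ^ (DIM('a) - 1) *\<^sub>R (LINT \<theta>|sphere_measure 0 1. F (R *\<^sub>R \<theta>))) (at R)"
proof -
  let ?n = "DIM('a)" and ?A = "sphere_area TYPE('a)"
  define I where "I = (LINT \<theta>|sphere_measure 0 1. F (R *\<^sub>R \<theta>))"
  define e where "e S = ball_integral F S - (S ^ ?n / ?n) *\<^sub>R I" for S
  define \<phi> where "\<phi> S = ?A / ?n * S ^ ?n" for S :: real
  have A: "?A > 0" by (rule sphere_area_pos)
  have pow: "((\<lambda>S. S ^ ?n / ?n) has_real_derivative R ^ (?n - 1)) (at R)"
    by (auto intro!: derivative_eq_intros)
  have "(e has_vector_derivative 0) (at R)"
  proof (rule has_vector_derivative_zero_comparison)
    show "(\<phi> has_real_derivative ?A / ?n * (?n * R ^ (?n - 1))) (at R)"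
      unfolding \<phi>_def by (auto intro!: derivative_eq_intros)
    fix \<epsilon> :: real assume \<epsilon>: "\<epsilon> > 0"
    \<comment> \<open>Points whose norm differs from \<open>R\<close> by less than \<open>R\<close>,
      and their projections to the sphere of radius \<open>R\<close>, all lie in this ball.\<close>
    have "uniformly_continuous_on (cball 0 (R + R)) F"
      by (rule compact_uniformly_continuous) (use F continuous_on_subset in auto)
    then obtain d where d: "d > 0" "\<And>x y. norm x \<le> R + R \<Longrightarrow> norm y \<le> R + R \<Longrightarrow>
        dist y x < d \<Longrightarrow> dist (F y) (F x) < \<epsilon>"
      using \<epsilon> unfolding uniformly_continuous_on_def by auto
    have close: "norm (F x - F ((R / norm x) *\<^sub>R x)) \<le> \<epsilon>"
      if "\<bar>norm x - R\<bar> < min d R" for x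
    proof -
      have x: "x \<noteq> 0" using that R by auto
      have "x - (R / norm x) *\<^sub>R x = (1 - R / norm x) *\<^sub>R x"
        by (simp add: scaleR_diff_left)
      then have "norm (x - (R / norm x) *\<^sub>R x) = \<bar>1 - R / norm x\<bar> * \<bar>norm x\<bar>"
        by simp
      also have "\<dots> = \<bar>norm x - R\<bar>"
      proof -
        have "(1 - R / norm x) * norm x = norm x - R"
          using x by (simp add: left_diff_distrib)
        then show ?thesis by (simp only: abs_mult[symmetric])
      qed
      finally have "dist x ((R / norm x) *\<^sub>R x) < d"
        using that by (simp add: dist_norm)
      moreover have "norm x \<le> R + R" "norm ((R / norm x) *\<^sub>R x) \<le> R + R"
        using that R x by auto
      ultimately show ?thesis
        using d(2) by (simp add: dist_norm less_imp_le)
    qed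
    show "\<exists>d>0. \<forall>S. \<bar>S - R\<bar> < d \<longrightarrow> norm (e S - e R) \<le> \<epsilon> * \<bar>\<phi> S - \<phi> R\<bar>"
    proof (intro exI[of _ "min d R"] conjI allI impI)
      fix S assume S: "\<bar>S - R\<bar> < min d R"
      have Spos: "S > 0" using S by linarith
      show "norm (e S - e R) \<le> \<epsilon> * \<bar>\<phi> S - \<phi> R\<bar>"
      proof (cases "S \<le> R")
        case True
        have "norm (e R - e S) \<le> \<epsilon> * (?A / ?n * (R ^ ?n - S ^ ?n))"
          unfolding e_def I_def
          by (intro annulus_integral_bound[OF F R Spos True] close) (use S in linarith)
        also have "\<dots> = \<epsilon> * (\<phi> R - \<phi> S)"
          by (simp add: \<phi>_def algebra_simps)
        also have "\<dots> \<le> \<epsilon> * \<bar>\<phi> S - \<phi> R\<bar>"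
          using \<epsilon> by (intro mult_left_mono) auto
        finally show ?thesis by (simp add: norm_minus_commute)
      next
        case False
        have "norm (e S - e R) \<le> \<epsilon> * (?A / ?n * (S ^ ?n - R ^ ?n))"
          unfolding e_def I_def
          by (intro annulus_integral_bound[OF F R R] close) (use S False in linarith)+
        also have "\<dots> = \<epsilon> * (\<phi> S - \<phi> R)"
          by (simp add: \<phi>_def algebra_simps)
        also have "\<dots> \<le> \<epsilon> * \<bar>\<phi> S - \<phi> R\<bar>"
          using \<epsilon> by (intro mult_left_mono) auto
        finally show ?thesis .
      qed
    qed (use d R in auto)
  qed
  from has_vector_derivative_add[OF this has_vector_derivative_scaleR[OF pow has_vector_derivative_const, of I]]
  have "((\<lambda>S. e S + (S ^ ?n / ?n) *\<^sub>R I) has_vector_derivative R ^ (?n - 1) *\<^sub>R I) (at R)"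
    by (simp only: scaleR_zero_right add_0)
  moreover have "(\<lambda>S. e S + (S ^ ?n / ?n) *\<^sub>R I) = ball_integral F"
    by (simp add: e_def fun_eq_iff)
  ultimately show ?thesis
    by (simp only: I_def)
qed

subsection \<open>The divergence theorem for balls\<close>

lemma continuous_bounded_on_cball:
  fixes f :: "'a::euclidean_space \<Rightarrow> 'b::real_normed_vector"
  assumes "continuous_on UNIV f"
  obtains B where "\<And>x. norm x \<le> R \<Longrightarrow> norm (f x) \<le> B"
proof -
  have "bounded (f ` cball 0 R)"
    by (intro compact_imp_bounded compact_continuous_image compact_cball
        continuous_on_subset[OF assms subset_UNIV])
  then obtain B where "\<forall>y\<in>f ` cball 0 R. norm y \<le> B"
    unfolding bounded_iff by blast
  then show thesis by (intro that[of B]) auto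
qed

text \<open>The mean value inequality on the segment from \<open>x\<close> in direction
  \<open>b\<close>. A bound on the derivative in this one direction is enough, which matches the
  continuity assumed in the divergence theorem below.\<close>

lemma directional_derivative_bound:
  fixes u :: "'a::euclidean_space \<Rightarrow> 'b::real_normed_vector"
  assumes D: "\<And>x. (u has_derivative D x) (at x)"
    and B: "\<And>s. 0 \<le> s \<Longrightarrow> s \<le> t \<Longrightarrow> norm (D (x + s *\<^sub>R b) b) \<le> B"
    and t: "0 \<le> t"
  shows "norm (u (x + t *\<^sub>R b) - u x) \<le> B * t"
proof -
  have "((\<lambda>s. u (x + s *\<^sub>R b)) has_derivative
      (\<lambda>h. D (x + s *\<^sub>R b) (h *\<^sub>R b))) (at s within {0..t})" for s
    by (rule has_derivative_at_withinI, rule has_derivative_compose[OF _ D])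
      (auto intro!: derivative_eq_intros)
  moreover have "onorm (\<lambda>h. D (x + s *\<^sub>R b) (h *\<^sub>R b)) \<le> B" if "s \<in> {0..t}" for s
  proof (rule onorm_le)
    fix h :: real
    have "D (x + s *\<^sub>R b) (h *\<^sub>R b) = h *\<^sub>R D (x + s *\<^sub>R b) b"
      by (rule linear_scale[OF has_derivative_linear[OF D]])
    then show "norm (D (x + s *\<^sub>R b) (h *\<^sub>R b)) \<le> B * norm h"
      using B[of s] that mult_left_mono[OF B[of s], of "\<bar>h\<bar>"] by (simp add: mult.commute)
  qed
  ultimately show ?thesis
    using differentiable_bound[of "{0..t}" "\<lambda>s. u (x + s *\<^sub>R b)"
        "\<lambda>s h. D (x + s *\<^sub>R b) (h *\<^sub>R b)" B t 0] t by auto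
qed

lemma norm_add_unit_squared:
  fixes x b :: "'a::real_inner"
  assumes "norm b = 1"
  shows "(norm (x + \<tau> *\<^sub>R b))\<^sup>2 = (norm x)\<^sup>2 + 2 * \<tau> * (x \<bullet> b) + \<tau>\<^sup>2"
proof -
  have "b \<bullet> b = 1" using assms by (simp add: norm_eq_1)
  then show ?thesis
    unfolding power2_norm_eq_inner
    by (simp add: inner_add_left inner_add_right inner_commute power2_eq_square)
qed

text \<open>The integrand is the derivative along \<open>b\<close> of the Lipschitz function \<open>max 0 (R\<^sup>2 - \<bar>x\<bar>\<^sup>2) u\<close>; its
  difference quotients integrate to zero by translation invariance.\<close>

lemma integral_cutoff_derivative_zero:
  fixes u :: "'a::euclidean_space \<Rightarrow> 'b::{banach, second_countable_topology}"
  assumes D: "\<And>x. (u has_derivative D x) (at x)"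
    and cont: "continuous_on UNIV (\<lambda>x. D x b)" and b: "norm b = 1" and R: "R > 0"
  shows "(LINT x|lborel. indicator (cball 0 R) x *\<^sub>R
    ((R\<^sup>2 - (norm x)\<^sup>2) *\<^sub>R D x b - (2 * (x \<bullet> b)) *\<^sub>R u x)) = 0"
proof -
  define \<psi> where "\<psi> x = max 0 (R\<^sup>2 - (norm x)\<^sup>2)" for x :: 'a
  define w where "w x = \<psi> x *\<^sub>R u x" for x
  \<comment> \<open>Step sizes in the interval from 0 to 1, taken as a sequence for the sake of
    dominated convergence.\<close>
  define t where "t k = inverse (real (Suc k))" for k
  define s where "s k x = (1 / t k) *\<^sub>R (w (x + t k *\<^sub>R b) - w x)" for k x
  define v where "v x = indicator (cball 0 R) x *\<^sub>R
    ((R\<^sup>2 - (norm x)\<^sup>2) *\<^sub>R D x b - (2 * (x \<bullet> b)) *\<^sub>R u x)" for x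
  have ucont: "continuous_on UNIV u"
    using D by (intro continuous_at_imp_continuous_on) (auto intro: has_derivative_continuous)
  have wcont: "continuous_on UNIV w"
    unfolding w_def \<psi>_def by (intro continuous_intros ucont)
  have \<psi>0: "\<psi> x = 0" if "norm x \<ge> R" for x
    using power_mono[OF that, of 2] R by (simp add: \<psi>_def)
  have \<psi>le: "0 \<le> \<psi> x" "\<psi> x \<le> R\<^sup>2" for x
    by (simp_all add: \<psi>_def)
  have t: "0 < t k" "t k \<le> 1" for k
    by (auto simp: t_def inverse_le_1_iff)
  have tlim: "t \<longlonglongrightarrow> 0"
    unfolding t_def by (rule LIMSEQ_inverse_real_of_nat)
  \<comment> \<open>\<open>w\<close> vanishes outside the ball of radius \<open>R\<close>, so shifts
    of length at most 1 stay supported in radius \<open>R + 1\<close>.\<close>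
  have supp: "w (x + \<tau> *\<^sub>R b) = indicator (cball 0 (R + 1)) x *\<^sub>R w (x + \<tau> *\<^sub>R b)"
    if "0 \<le> \<tau>" "\<tau> \<le> 1" for x \<tau>
  proof (cases "norm x \<le> R + 1")
    case False
    have "norm x \<le> norm (x + \<tau> *\<^sub>R b) + norm (\<tau> *\<^sub>R b)"
      using norm_triangle_ineq4[of "x + \<tau> *\<^sub>R b" "\<tau> *\<^sub>R b"] by simp
    then have "norm (x + \<tau> *\<^sub>R b) \<ge> R" using False that b by simp
    then show ?thesis using \<psi>0 by (simp add: w_def)
  qed simp
  have wint: "integrable lborel (\<lambda>x. w (x + \<tau> *\<^sub>R b))" if "0 \<le> \<tau>" "\<tau> \<le> 1" for \<tau>
    by (subst supp[OF that], rule ball_integrable)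
      (intro continuous_on_compose2[OF wcont] continuous_intros subset_UNIV)
  have wm: "w \<in> borel_measurable borel"
    by (rule borel_measurable_continuous_onI[OF wcont])
  have s0: "(LINT x|lborel. s k x) = 0" for k
  proof -
    have "(LINT x|lborel. w (x + t k *\<^sub>R b)) = (LINT x|lborel. w x)"
      using lborel_integral_affine[OF wm, of 1 "t k *\<^sub>R b"] by (simp add: add.commute)
    then show ?thesis
      unfolding s_def using wint[of "t k"] wint[of 0] t[of k] by (simp add: less_imp_le)
  qed
  obtain U where U: "\<And>x. norm x \<le> R + 2 \<Longrightarrow> norm (u x) \<le> U"
    using continuous_bounded_on_cball[OF ucont] by blast
  obtain U' where U': "\<And>x. norm x \<le> R + 2 \<Longrightarrow> norm (D x b) \<le> U'"
    using continuous_bounded_on_cball[OF cont] by blast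
  \<comment> \<open>The product rule for difference quotients: on radius \<open>R + 1\<close> the
    quotient of \<open>\<psi>\<close> is at most \<open>2 * (R + 1) + 1\<close>, that of
    \<open>u\<close> at most \<open>U'\<close>, and \<open>\<psi>\<close> itself at most the square
    of \<open>R\<close>. The bounds \<open>U\<close> and \<open>U'\<close> are taken on radius
    \<open>R + 2\<close> to cover the shifted points.\<close>
  define L where "L = (2 * (R + 1) + 1) * U + R\<^sup>2 * U'"
  have bound: "norm (s k x) \<le> indicator (cball 0 (R + 1)) x *\<^sub>R L" for k x
  proof (cases "norm x \<le> R + 1")
    case False
    then show ?thesis
      using supp[of "t k" x] supp[of 0 x] t[of k] by (simp add: s_def less_imp_le)
  next
    case True
    let ?y = "x + t k *\<^sub>R b"
    have ny: "norm (x + \<tau> *\<^sub>R b) \<le> R + 2" if "0 \<le> \<tau>" "\<tau> \<le> t k" for \<tau>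
      using norm_triangle_ineq[of x "\<tau> *\<^sub>R b"] that True t[of k] b by simp
    have "(norm ?y)\<^sup>2 - (norm x)\<^sup>2 = t k * (2 * (x \<bullet> b) + t k)"
      unfolding norm_add_unit_squared[OF b] by (simp add: algebra_simps power2_eq_square)
    moreover have "\<bar>x \<bullet> b\<bar> \<le> R + 1"
      using Cauchy_Schwarz_ineq2[of x b] True b by simp
    ultimately have "\<bar>(norm ?y)\<^sup>2 - (norm x)\<^sup>2\<bar> \<le> t k * (2 * (R + 1) + 1)"
      using t[of k] by (auto simp: abs_mult intro!: mult_left_mono)
    moreover have "\<bar>max 0 (p - q) - max 0 (p - r)\<bar> \<le> \<bar>q - r\<bar>" for p q r :: real
      by linarith
    ultimately have d\<psi>: "\<bar>\<psi> ?y - \<psi> x\<bar> \<le> t k * (2 * (R + 1) + 1)"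
      unfolding \<psi>_def by (rule order_trans[rotated])
    have du: "norm (u ?y - u x) \<le> U' * t k"
      by (rule directional_derivative_bound[OF D]) (use U' ny t[of k] in auto)
    have "w ?y - w x = (\<psi> ?y - \<psi> x) *\<^sub>R u ?y + \<psi> x *\<^sub>R (u ?y - u x)"
      by (simp add: w_def algebra_simps)
    then have "norm (w ?y - w x) \<le> \<bar>\<psi> ?y - \<psi> x\<bar> * norm (u ?y) + \<psi> x * norm (u ?y - u x)"
      using norm_triangle_ineq[of "(\<psi> ?y - \<psi> x) *\<^sub>R u ?y" "\<psi> x *\<^sub>R (u ?y - u x)"] \<psi>le(1)[of x] by simp
    also have "\<dots> \<le> (t k * (2 * (R + 1) + 1)) * U + R\<^sup>2 * (U' * t k)"
      using d\<psi> du U[OF ny[of "t k"]] t[of k] \<psi>le[of x] R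
      by (intro add_mono mult_mono) (auto intro!: mult_nonneg_nonneg)
    also have "\<dots> = t k * L" by (simp add: L_def algebra_simps)
    finally have "norm (s k x) \<le> L"
      using t[of k] by (simp add: s_def pos_divide_le_eq mult.commute)
    then show ?thesis using True by simp
  qed
  \<comment> \<open>The cutoff has a kink on the sphere of radius \<open>R\<close>, so convergence
    is claimed only off that null set. Inside, the maximum is attained by the quadratic term;
    outside, \<open>w\<close> is locally zero.\<close>
  have lim: "(\<lambda>k. s k x) \<longlonglongrightarrow> v x" if x: "norm x \<noteq> R" for x
  proof -
    have "((\<lambda>\<tau>. w (x + \<tau> *\<^sub>R b)) has_vector_derivative v x) (at 0)"
    proof (cases "norm x < R")
      case True
      have D0: "((\<lambda>\<tau>. u (x + \<tau> *\<^sub>R b)) has_vector_derivative D x b) (at 0)"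
      proof -
        have "((\<lambda>\<tau>. u (x + \<tau> *\<^sub>R b)) has_derivative (\<lambda>h. D (x + 0 *\<^sub>R b) (h *\<^sub>R b))) (at 0)"
          by (rule has_derivative_compose[OF _ D]) (auto intro!: derivative_eq_intros)
        moreover have "D x (h *\<^sub>R b) = h *\<^sub>R D x b" for h
          by (rule linear_scale[OF has_derivative_linear[OF D]])
        ultimately show ?thesis by (simp add: has_vector_derivative_def)
      qed
      have "((\<lambda>\<tau>. R\<^sup>2 - ((norm x)\<^sup>2 + 2 * \<tau> * (x \<bullet> b) + \<tau>\<^sup>2)) has_real_derivative - (2 * (x \<bullet> b))) (at 0)"
        by (auto intro!: derivative_eq_intros)
      from has_vector_derivative_scaleR[OF this D0]
      have *: "((\<lambda>\<tau>. (R\<^sup>2 - ((norm x)\<^sup>2 + 2 * \<tau> * (x \<bullet> b) + \<tau>\<^sup>2)) *\<^sub>R u (x + \<tau> *\<^sub>R b))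
          has_vector_derivative v x) (at 0)"
        using True by (simp add: v_def add.commute)
      have "(R\<^sup>2 - ((norm x)\<^sup>2 + 2 * \<tau> * (x \<bullet> b) + \<tau>\<^sup>2)) *\<^sub>R u (x + \<tau> *\<^sub>R b)
          = w (x + \<tau> *\<^sub>R b)" if "norm (x + \<tau> *\<^sub>R b) < R" for \<tau>
      proof -
        have "(norm (x + \<tau> *\<^sub>R b))\<^sup>2 = (norm x)\<^sup>2 + 2 * \<tau> * (x \<bullet> b) + \<tau>\<^sup>2"
          by (rule norm_add_unit_squared[OF b])
        moreover have "(norm (x + \<tau> *\<^sub>R b))\<^sup>2 \<le> R\<^sup>2"
          using that by (intro power_mono) auto
        ultimately show ?thesis by (simp add: w_def \<psi>_def)
      qed
      then show ?thesis
        using True by (intro has_vector_derivative_transform_within_open[OF *,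
            where S="{\<tau>. norm (x + \<tau> *\<^sub>R b) < R}"] open_Collect_less continuous_intros) auto
    next
      case False
      then have x: "norm x > R" using x by simp
      have "((\<lambda>\<tau>. 0) has_vector_derivative v x) (at 0)"
        using x by (simp add: v_def)
      then show ?thesis
        using x by (rule_tac has_vector_derivative_transform_within_open[
            where S="{\<tau>. R < norm (x + \<tau> *\<^sub>R b)}"])
          (auto intro!: open_Collect_less continuous_intros simp: w_def \<psi>0)
    qed
    then have "((\<lambda>\<tau>. (1 / norm \<tau>) *\<^sub>R (w (x + \<tau> *\<^sub>R b) - (w x + \<tau> *\<^sub>R v x))) \<longlongrightarrow> 0) (at 0)"
      unfolding has_vector_derivative_def has_derivative_within by (simp add: inverse_eq_divide)
    then have "(\<lambda>k. (1 / norm (t k)) *\<^sub>R (w (x + t k *\<^sub>R b) - (w x + t k *\<^sub>R v x))) \<longlonglongrightarrow> 0"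
      by (rule filterlim_compose)
        (use tlim t in \<open>auto simp: filterlim_at less_imp_neq[symmetric]\<close>)
    also have "(\<lambda>k. (1 / norm (t k)) *\<^sub>R (w (x + t k *\<^sub>R b) - (w x + t k *\<^sub>R v x))) = (\<lambda>k. s k x - v x)"
    proof
      fix k
      have "norm (t k) = t k" "t k \<noteq> 0" using t(1)[of k] by simp_all
      then show "(1 / norm (t k)) *\<^sub>R (w (x + t k *\<^sub>R b) - (w x + t k *\<^sub>R v x)) = s k x - v x"
        by (simp add: s_def algebra_simps)
    qed
    finally show ?thesis by (simp add: LIM_zero_iff)
  qed
  have "(\<lambda>k. LINT x|lborel. s k x) \<longlonglongrightarrow> (LINT x|lborel. v x)"
  proof (rule integral_dominated_convergence)
    have "integrable lborel v"
      unfolding v_def by (rule ball_integrable) (intro continuous_intros ucont cont)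
    then show "v \<in> borel_measurable lborel" by simp
    show "s k \<in> borel_measurable lborel" for k
      unfolding s_def using wint[of "t k"] wint[of 0] t[of k]
      by (intro borel_measurable_integrable integrable_scaleR_right Bochner_Integration.integrable_diff)
        (auto simp: less_imp_le)
    show "integrable lborel (\<lambda>x. indicator (cball 0 (R + 1)) x *\<^sub>R L)"
      by (rule ball_integrable) auto
    have "sphere 0 R \<in> null_sets (lborel :: 'a measure)"
      using negligible_sphere[of "0::'a" R]
      by (auto simp: null_sets_completion_iff negligible_iff_null_sets)
    then have "AE x in (lborel :: 'a measure). x \<notin> sphere 0 R"
      by (rule AE_not_in)
    then show "AE x in lborel. (\<lambda>k. s k x) \<longlonglongrightarrow> v x"
      by eventually_elim (rule lim, auto)
  qed (use bound in auto)
  then show ?thesis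
    unfolding s0 v_def using LIMSEQ_unique tendsto_const by blast
qed

text \<open>Differentiating the cutoff identity in the radius turns it into the divergence theorem
  for the ball.\<close>

theorem ball_integral_directional_derivative:
  fixes u :: "'a::euclidean_space \<Rightarrow> 'b::{banach, second_countable_topology}"
  assumes D: "\<And>x. (u has_derivative D x) (at x)"
    and cont: "continuous_on UNIV (\<lambda>x. D x b)" and b: "norm b = 1" and R: "R > 0"
  shows "R *\<^sub>R ball_integral (\<lambda>x. D x b) R =
    R ^ (DIM('a) - 1) *\<^sub>R (LINT \<theta>|sphere_measure 0 1. ((R *\<^sub>R \<theta>) \<bullet> b) *\<^sub>R u (R *\<^sub>R \<theta>))"
proof -
  let ?n = "DIM('a)"
  have ucont: "continuous_on UNIV u"
    using D by (intro continuous_at_imp_continuous_on) (auto intro: has_derivative_continuous)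
  define du where "du x = D x b" for x
  define F where "F x = (norm x)\<^sup>2 *\<^sub>R du x" for x
  define G where "G x = (x \<bullet> b) *\<^sub>R u x" for x
  have du: "continuous_on UNIV du" using cont by (simp add: du_def[abs_def])
  have F: "continuous_on UNIV F" unfolding F_def by (intro continuous_intros du)
  have G: "continuous_on UNIV G" unfolding G_def by (intro continuous_intros ucont)
  \<comment> \<open>The cutoff identity split into three ball integrals, so that each can be
    differentiated in the radius.\<close>
  define V where "V r = r\<^sup>2 *\<^sub>R ball_integral du r - ball_integral F r - 2 *\<^sub>R ball_integral G r" for r
  have V0: "V r = 0" if "r > 0" for r
  proof -
    let ?i = "\<lambda>x. indicator (cball (0::'a) r) x :: real"
    have "V r = (LINT x|lborel. r\<^sup>2 *\<^sub>R (?i x *\<^sub>R du x) - ?i x *\<^sub>R F x - 2 *\<^sub>R (?i x *\<^sub>R G x))"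
      unfolding V_def ball_integral_def
      using ball_integrable[OF du, of r] ball_integrable[OF F, of r] ball_integrable[OF G, of r]
      by (simp del: scaleR_scaleR)
    also have "\<dots> = (LINT x|lborel. ?i x *\<^sub>R
        ((r\<^sup>2 - (norm x)\<^sup>2) *\<^sub>R D x b - (2 * (x \<bullet> b)) *\<^sub>R u x))"
      by (simp add: F_def G_def du_def algebra_simps)
    also have "\<dots> = 0"
      by (rule integral_cutoff_derivative_zero[OF D cont b that])
    finally show ?thesis .
  qed
  let ?S = "\<lambda>H. LINT \<theta>|sphere_measure 0 1. H (R *\<^sub>R \<theta>)"
  \<comment> \<open>On the sphere the squared norm is constant, so in the derivative of
    \<open>V\<close> the surface terms of the first two ball integrals cancel. What remains is the
    divergence theorem.\<close>
  have SF: "?S F = R\<^sup>2 *\<^sub>R ?S du"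
  proof -
    have "?S F = (LINT \<theta>|sphere_measure 0 1. R\<^sup>2 *\<^sub>R du (R *\<^sub>R \<theta>))"
      by (rule Bochner_Integration.integral_cong) (use R in \<open>auto simp: F_def\<close>)
    then show ?thesis by simp
  qed
  have "((\<lambda>r. r\<^sup>2) has_real_derivative 2 * R) (at R)"
    by (auto intro!: derivative_eq_intros)
  note dV = has_vector_derivative_diff[OF has_vector_derivative_diff[OF
        has_vector_derivative_scaleR[OF this ball_integral_has_vector_derivative[OF du R]]
        ball_integral_has_vector_derivative[OF F R]]
      bounded_linear.has_vector_derivative[OF bounded_linear_scaleR_right
        ball_integral_has_vector_derivative[OF G R], of 2], folded V_def]
  have "((\<lambda>r. 0) has_vector_derivative
     (R\<^sup>2 *\<^sub>R R ^ (?n - 1) *\<^sub>R ?S du + (2 * R) *\<^sub>R ball_integral du R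
      - R ^ (?n - 1) *\<^sub>R ?S F - 2 *\<^sub>R R ^ (?n - 1) *\<^sub>R ?S G)) (at R)"
    by (rule has_vector_derivative_transform_within_open[OF dV, of "{0<..}"]) (use R V0 in auto)
  then have "R\<^sup>2 *\<^sub>R R ^ (?n - 1) *\<^sub>R ?S du + (2 * R) *\<^sub>R ball_integral du R
      - R ^ (?n - 1) *\<^sub>R ?S F - 2 *\<^sub>R R ^ (?n - 1) *\<^sub>R ?S G = 0"
    using vector_derivative_unique_at has_vector_derivative_const by blast
  then have "2 *\<^sub>R (R *\<^sub>R ball_integral du R) = 2 *\<^sub>R (R ^ (?n - 1) *\<^sub>R ?S G)"
    by (simp add: SF algebra_simps)
  then have "R *\<^sub>R ball_integral du R = R ^ (?n - 1) *\<^sub>R ?S G"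
    by (simp only: scaleR_cancel_left) simp
  then show ?thesis
    by (simp only: G_def du_def[abs_def])
qed

text \<open>The exponent is one below that of the surface element. With this normalisation the
  divergence theorem identifies the mean of \<open>(x \<bullet> b) u\<close> with a ball integral of
  the derivative of \<open>u\<close>, free of further powers of the radius.\<close>

definition radial_mean :: "('a::euclidean_space \<Rightarrow> 'b::{banach, second_countable_topology}) \<Rightarrow> real \<Rightarrow> 'b" where
  "radial_mean u r = r ^ (DIM('a) - 2) *\<^sub>R (LINT \<theta>|sphere_measure 0 1. u (r *\<^sub>R \<theta>))"

text \<open>By the divergence theorem the radial mean on the left is the ball integral of
  \<open>D x b\<close>, whose derivative in the radius is a sphere integral of
  \<open>D x b\<close>.\<close>

theorem radial_mean_has_vector_derivative:
  fixes u :: "'a::euclidean_space \<Rightarrow> 'b::{banach, second_countable_topology}"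
  assumes D: "\<And>x. (u has_derivative D x) (at x)"
    and cont: "continuous_on UNIV (\<lambda>x. D x b)" and b: "norm b = 1" and R: "R > 0"
    and n: "DIM('a) \<ge> 2"
  shows "(radial_mean (\<lambda>x. (x \<bullet> b) *\<^sub>R u x) has_vector_derivative
    R *\<^sub>R radial_mean (\<lambda>x. D x b) R) (at R)"
proof -
  \<comment> \<open>The dimension bound makes the truncated subtraction exact.\<close>
  have pow: "r ^ (DIM('a) - 1) = r * r ^ (DIM('a) - 2)" for r :: real
    using n by (simp flip: power_Suc add: Suc_diff_Suc numeral_2_eq_2)
  have eq: "ball_integral (\<lambda>x. D x b) r = radial_mean (\<lambda>x. (x \<bullet> b) *\<^sub>R u x) r" if "r > 0" for r
  proof -
    have "r *\<^sub>R ball_integral (\<lambda>x. D x b) r = r *\<^sub>R radial_mean (\<lambda>x. (x \<bullet> b) *\<^sub>R u x) r"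
      unfolding ball_integral_directional_derivative[OF D cont b that]
      by (simp add: radial_mean_def pow del: One_nat_def)
    then show ?thesis using that by (simp only: scaleR_cancel_left) simp
  qed
  have "(ball_integral (\<lambda>x. D x b) has_vector_derivative R *\<^sub>R radial_mean (\<lambda>x. D x b) R) (at R)"
    using ball_integral_has_vector_derivative[OF cont R] by (simp add: radial_mean_def pow del: One_nat_def)
  then show ?thesis
    by (rule has_vector_derivative_transform_within_open[of _ _ _ "{0<..}"]) (use R eq in auto)
qed

subsection \<open>Partial derivatives and smoothness\<close>

lemma partial_derivative_eq:
  assumes "(f has_derivative D) (at x)"
  shows "partial_derivative i f x = D (axis i 1)"
proof -
  have "((\<lambda>s. f (x + s *\<^sub>R axis i 1)) has_derivative (\<lambda>s. D (s *\<^sub>R axis i 1))) (at 0)"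
    by (rule has_derivative_compose[where g=f and f="\<lambda>s. x + s *\<^sub>R axis i 1"])
      (use assms in \<open>auto intro!: derivative_eq_intros\<close>)
  moreover have "D (s *\<^sub>R axis i 1) = s *\<^sub>R D (axis i 1)" for s
    by (rule linear_scale[OF has_derivative_linear[OF assms]])
  ultimately show ?thesis
    by (simp add: partial_derivative_def vector_derivative_at has_vector_derivative_def)
qed

lemma has_derivative_partials:
  fixes f :: "real ^ 'n \<Rightarrow> complex"
  assumes "f differentiable (at x)"
  shows "(f has_derivative (\<lambda>h. \<Sum>i\<in>UNIV. (h $ i) *\<^sub>R partial_derivative i f x)) (at x)"
proof -
  obtain D where D: "(f has_derivative D) (at x)"
    using assms by (auto simp: differentiable_def)
  have "D h = (\<Sum>i\<in>UNIV. (h $ i) *\<^sub>R partial_derivative i f x)" for h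
  proof -
    have "h = (\<Sum>i\<in>UNIV. (h $ i) *\<^sub>R axis i 1)"
      using basis_expansion[of h] by (simp add: scalar_mult_eq_scaleR)
    then have "D h = D (\<Sum>i\<in>UNIV. (h $ i) *\<^sub>R axis i 1)" by simp
    also have "\<dots> = (\<Sum>i\<in>UNIV. (h $ i) *\<^sub>R D (axis i 1))"
      by (simp add: linear_sum[OF has_derivative_linear[OF D]]
          linear_scale[OF has_derivative_linear[OF D]])
    finally show ?thesis by (simp add: partial_derivative_eq[OF D])
  qed
  then have "D = (\<lambda>h. \<Sum>i\<in>UNIV. (h $ i) *\<^sub>R partial_derivative i f x)" by blast
  then show ?thesis using D by simp
qed

lemma sum_axis_scaleR [simp]:
  fixes v :: "'n::finite \<Rightarrow> 'b::real_vector"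
  shows "(\<Sum>j\<in>UNIV. (axis i (1::real) $ j) *\<^sub>R v j) = v i"
proof -
  have "(\<Sum>j\<in>UNIV. (axis i (1::real) $ j) *\<^sub>R v j) = (\<Sum>j\<in>UNIV. if j = i then v j else 0)"
    by (intro sum.cong) (auto simp: axis_def)
  then show ?thesis by simp
qed

lemma C_infinity_continuous: "C_infinity f \<Longrightarrow> continuous_on UNIV f"
  unfolding C_infinity_def by (metis C_k.simps(1))

lemma C_infinity_differentiable: "C_infinity f \<Longrightarrow> f differentiable (at x)"
  unfolding C_infinity_def differentiable_def by (metis C_k.simps(2))

lemma C_infinity_partial_derivative:
  fixes f :: "real ^ 'n \<Rightarrow> complex"
  assumes "C_infinity f"
  shows "C_infinity (partial_derivative i f)"
  unfolding C_infinity_def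
proof
  fix k
  obtain D where D: "\<And>x. (f has_derivative D x) (at x)" "\<forall>b\<in>Basis. C_k k (\<lambda>x. D x b)"
    using assms unfolding C_infinity_def by (metis C_k.simps(2))
  have "axis i 1 \<in> (Basis :: (real ^ 'n) set)"
    by (simp add: axis_in_Basis_iff)
  moreover have "(\<lambda>x. D x (axis i 1)) = partial_derivative i f"
    using partial_derivative_eq[OF D(1)] by auto
  ultimately show "C_k k (partial_derivative i f)"
    using D(2) by metis
qed

text \<open>Coinduction for smoothness: on a class of differentiable functions closed under partial
  derivatives, every \<open>C_k\<close> follows by induction on the order. It serves for spherical
  means, whose partial derivatives are again spherical means.\<close>

lemma C_infinity_coinduct:
  fixes f :: "real ^ 'n \<Rightarrow> complex"
  assumes "X f"
    and diff: "\<And>f x. X f \<Longrightarrow> f differentiable (at x)"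
    and part: "\<And>f i. X f \<Longrightarrow> X (partial_derivative i f)"
  shows "C_infinity f"
proof -
  have "X f \<Longrightarrow> C_k k f" for k f
  proof (induction k arbitrary: f)
    case (Suc k)
    have "C_k k (\<lambda>x. \<Sum>i\<in>UNIV. (b $ i) *\<^sub>R partial_derivative i f x)"
      if b: "b \<in> Basis" for b :: "real ^ 'n"
    proof -
      obtain i where "b = axis i 1"
        using b by (auto simp: Basis_vec_def)
      then show ?thesis using Suc.IH[OF part[OF Suc.prems]] by (simp add: eta_contract_eq)
    qed
    then show ?case
      using has_derivative_partials[OF diff[OF Suc.prems]] unfolding C_k.simps
      by (intro exI[of _ "\<lambda>x h. \<Sum>i\<in>UNIV. (h $ i) *\<^sub>R partial_derivative i f x"]) blast
  qed (auto intro!: continuous_at_imp_continuous_on differentiable_imp_continuous_within diff)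
  then show ?thesis using assms(1) by (simp add: C_infinity_def)
qed

lemma partial_derivative_add:
  assumes "f differentiable (at x)" "g differentiable (at x)"
  shows "partial_derivative i (\<lambda>x. f x + g x) x = partial_derivative i f x + partial_derivative i g x"
  using partial_derivative_eq[OF has_derivative_add[OF has_derivative_partials[OF assms(1)]
        has_derivative_partials[OF assms(2)]], of i] by simp

lemma partial_derivative_mult:
  assumes "f differentiable (at x)" "g differentiable (at x)"
  shows "partial_derivative i (\<lambda>x. f x * g x) x =
    f x * partial_derivative i g x + partial_derivative i f x * g x"
  using partial_derivative_eq[OF has_derivative_mult[OF has_derivative_partials[OF assms(1)]
        has_derivative_partials[OF assms(2)]], of i] by simp

lemma partial_derivative_const [simp]: "partial_derivative i (\<lambda>x. c) = (\<lambda>x. 0)"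
  using partial_derivative_eq[OF has_derivative_const] by fastforce

lemma coordinate_has_derivative:
  "((\<lambda>x. complex_of_real (x $ j)) has_derivative (\<lambda>h. complex_of_real (h $ j))) (at x)"
  by (intro bounded_linear_imp_has_derivative bounded_linear_of_real[THEN bounded_linear_compose]
      bounded_linear_vec_nth)

lemma partial_derivative_coordinate:
  "partial_derivative i (\<lambda>x. complex_of_real (x $ j)) = (\<lambda>x. of_real (axis i 1 $ j))"
  using partial_derivative_eq[OF coordinate_has_derivative] by fastforce

subsection \<open>Polynomials\<close>

text \<open>An inductive description rather than multi-index sums, so that closure under
  differentiation and symmetry of mixed partials follow by rule induction. Homogeneity is recorded
  separately.\<close>

inductive cpoly :: "(real ^ 'n \<Rightarrow> complex) \<Rightarrow> bool" where
  const: "cpoly (\<lambda>x. c)"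
| coordinate: "cpoly (\<lambda>x. of_real (x $ i))"
| add: "cpoly P \<Longrightarrow> cpoly Q \<Longrightarrow> cpoly (\<lambda>x. P x + Q x)"
| mult: "cpoly P \<Longrightarrow> cpoly Q \<Longrightarrow> cpoly (\<lambda>x. P x * Q x)"

lemma cpoly_sum: "(\<And>i. i \<in> I \<Longrightarrow> cpoly (P i)) \<Longrightarrow> cpoly (\<lambda>x. \<Sum>i\<in>I. P i x)"
  by (induction I rule: infinite_finite_induct) (auto intro: cpoly.intros)

lemma cpoly_prod: "(\<And>i. i \<in> I \<Longrightarrow> cpoly (P i)) \<Longrightarrow> cpoly (\<lambda>x. \<Prod>i\<in>I. P i x)"
  by (induction I rule: infinite_finite_induct) (auto intro: cpoly.intros)

lemma cpoly_power: "cpoly P \<Longrightarrow> cpoly (\<lambda>x. P x ^ k)"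
  by (induction k) (auto intro: cpoly.intros)

lemma cpoly_cnj: "cpoly P \<Longrightarrow> cpoly (\<lambda>x. cnj (P x))"
  by (induction rule: cpoly.induct) (auto intro: cpoly.intros)

lemma homogeneous_polynomial_cpoly: "homogeneous_polynomial m P \<Longrightarrow> cpoly P"
proof -
  assume "homogeneous_polynomial m P"
  then obtain c where "P = (\<lambda>x. \<Sum>\<alpha> | (\<Sum>i\<in>UNIV. \<alpha> i) = m. c \<alpha> * (\<Prod>i\<in>UNIV. of_real (x $ i) ^ \<alpha> i))"
    unfolding homogeneous_polynomial_def by blast
  then show ?thesis
    by (auto intro!: cpoly_sum cpoly.mult cpoly.const cpoly_prod cpoly_power cpoly.coordinate)
qed

lemma cpoly_differentiable: "cpoly P \<Longrightarrow> P differentiable (at x)"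
proof (induction rule: cpoly.induct)
  case (coordinate i)
  then show ?case using coordinate_has_derivative by (auto simp: differentiable_def)
qed auto

lemma cpoly_continuous: "cpoly P \<Longrightarrow> continuous_on UNIV P"
  using cpoly_differentiable differentiable_imp_continuous_within
  by (blast intro: continuous_at_imp_continuous_on)

lemma cpoly_partial_derivative: "cpoly P \<Longrightarrow> cpoly (partial_derivative i P)"
proof (induction rule: cpoly.induct)
  case (add P Q)
  then have "partial_derivative i (\<lambda>x. P x + Q x) =
      (\<lambda>x. partial_derivative i P x + partial_derivative i Q x)"
    by (simp add: fun_eq_iff partial_derivative_add cpoly_differentiable)
  then show ?case using add by (simp add: cpoly.add)
next
  case (mult P Q)
  then have "partial_derivative i (\<lambda>x. P x * Q x) =
      (\<lambda>x. P x * partial_derivative i Q x + partial_derivative i P x * Q x)"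
    by (simp add: fun_eq_iff partial_derivative_mult cpoly_differentiable)
  then show ?case using mult by (simp add: cpoly.add cpoly.mult)
qed (simp_all add: partial_derivative_coordinate cpoly.const)

text \<open>For polynomials this is algebra: the sum and product rules expand both orders into the
  same terms.\<close>

lemma partial_derivative_commute:
  "cpoly P \<Longrightarrow> partial_derivative i (partial_derivative j P) x = partial_derivative j (partial_derivative i P) x"
proof (induction arbitrary: x rule: cpoly.induct)
  case (add P Q)
  then have "partial_derivative k (\<lambda>x. P x + Q x) =
      (\<lambda>x. partial_derivative k P x + partial_derivative k Q x)" for k
    by (simp add: fun_eq_iff partial_derivative_add cpoly_differentiable)
  then show ?case
    using add by (simp add: partial_derivative_add cpoly_differentiable cpoly_partial_derivative)
next
  case (mult P Q)
  then have "partial_derivative k (\<lambda>x. P x * Q x) =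
      (\<lambda>x. P x * partial_derivative k Q x + partial_derivative k P x * Q x)" for k
    by (simp add: fun_eq_iff partial_derivative_mult cpoly_differentiable)
  then show ?case
    using mult by (simp add: partial_derivative_add partial_derivative_mult cpoly_differentiable
        cpoly_partial_derivative differentiable_mult)
qed (simp_all add: partial_derivative_coordinate)

lemma partial_derivative_sum:
  "(\<And>j. j \<in> J \<Longrightarrow> cpoly (P j)) \<Longrightarrow>
    partial_derivative i (\<lambda>x. \<Sum>j\<in>J. P j x) x = (\<Sum>j\<in>J. partial_derivative i (P j) x)"
  by (induction J rule: infinite_finite_induct)
    (simp_all add: partial_derivative_add cpoly_differentiable cpoly_sum)

section \<open>Solid harmonics: harmonic homogeneous polynomials\<close>

lemma laplacian_partial_derivative:
  assumes "cpoly P"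
  shows "laplacian (partial_derivative k P) x = partial_derivative k (laplacian P) x"
proof -
  have "partial_derivative i (partial_derivative k P) = partial_derivative k (partial_derivative i P)" for i
    using partial_derivative_commute[OF assms] by blast
  then have "laplacian (partial_derivative k P) x =
      (\<Sum>i\<in>UNIV. partial_derivative i (partial_derivative k (partial_derivative i P)) x)"
    by (simp add: laplacian_def)
  also have "\<dots> = (\<Sum>i\<in>UNIV. partial_derivative k (partial_derivative i (partial_derivative i P)) x)"
    by (intro sum.cong refl partial_derivative_commute cpoly_partial_derivative assms)
  also have "\<dots> = partial_derivative k (\<lambda>x. \<Sum>i\<in>UNIV. partial_derivative i (partial_derivative i P) x) x"
    by (rule partial_derivative_sum[symmetric]) (intro cpoly_partial_derivative assms)
  finally show ?thesis by (simp add: laplacian_def[abs_def])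
qed

text \<open>Homogeneity is stated through positive dilations, the form that can be differentiated
  both in \<open>x\<close> and in the dilation factor.\<close>

definition solid_harmonic :: "nat \<Rightarrow> (real ^ 'n \<Rightarrow> complex) \<Rightarrow> bool" where
  "solid_harmonic m Q \<longleftrightarrow> cpoly Q \<and> (\<forall>r>0. \<forall>x. Q (r *\<^sub>R x) = of_real (r ^ m) * Q x) \<and>
     (\<forall>x. laplacian Q x = 0)"

text \<open>Differentiating the homogeneity relation in \<open>x\<close> and cancelling one factor
  \<open>r\<close> lowers the degree; harmonicity survives since the Laplacian commutes with partial
  derivatives.\<close>

lemma solid_harmonic_partial_derivative:
  assumes "solid_harmonic (Suc m) Q"
  shows "solid_harmonic m (partial_derivative i Q)"
  unfolding solid_harmonic_def
proof (intro conjI allI impI)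
  have Q: "cpoly Q" "\<And>r x. r > 0 \<Longrightarrow> Q (r *\<^sub>R x) = of_real (r ^ Suc m) * Q x" "\<And>x. laplacian Q x = 0"
    using assms unfolding solid_harmonic_def by auto
  show "cpoly (partial_derivative i Q)" by (rule cpoly_partial_derivative[OF Q(1)])
  fix x
  have "laplacian Q = (\<lambda>x. 0)" using Q(3) by blast
  then show "laplacian (partial_derivative i Q) x = 0"
    by (simp add: laplacian_partial_derivative[OF Q(1)])
  fix r :: real assume r: "r > 0"
  have "((\<lambda>x. Q (r *\<^sub>R x)) has_derivative
      (\<lambda>h. \<Sum>i\<in>UNIV. ((r *\<^sub>R h) $ i) *\<^sub>R partial_derivative i Q (r *\<^sub>R x))) (at x)"
    by (rule has_derivative_compose[where f="\<lambda>x. r *\<^sub>R x"])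
      (auto intro!: derivative_eq_intros has_derivative_partials cpoly_differentiable Q(1))
  from partial_derivative_eq[OF this, of i]
  have 1: "partial_derivative i (\<lambda>x. Q (r *\<^sub>R x)) x = r *\<^sub>R partial_derivative i Q (r *\<^sub>R x)"
    by (simp flip: scaleR_scaleR scaleR_right.sum)
  have "partial_derivative i (\<lambda>x. of_real (r ^ Suc m) * Q x) x = of_real (r ^ Suc m) * partial_derivative i Q x"
    by (subst partial_derivative_mult) (auto simp: cpoly_differentiable[OF Q(1)])
  moreover have "(\<lambda>x. Q (r *\<^sub>R x)) = (\<lambda>x. of_real (r ^ Suc m) * Q x)"
    using Q(2)[OF r] by blast
  ultimately have "r *\<^sub>R partial_derivative i Q (r *\<^sub>R x) = r *\<^sub>R (of_real (r ^ m) * partial_derivative i Q x)"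
    using 1 by (simp only: scaleR_conv_of_real[where 'a=complex] power_Suc of_real_mult mult.assoc)
  then show "partial_derivative i Q (r *\<^sub>R x) = of_real (r ^ m) * partial_derivative i Q x"
    using r by (simp only: scaleR_cancel_left) simp
qed

text \<open>The derivative at \<open>r = 1\<close> of \<open>Q (r *\<^sub>R x)\<close> is computed
  by the chain rule and from homogeneity; the latter holds on the positive half-line, an open
  neighbourhood of 1.\<close>

lemma solid_harmonic_Euler:
  assumes "solid_harmonic m Q"
  shows "of_nat m * Q x = (\<Sum>i\<in>UNIV. (x $ i) *\<^sub>R partial_derivative i Q x)"
proof -
  have Q: "cpoly Q" "\<And>r x. r > 0 \<Longrightarrow> Q (r *\<^sub>R x) = of_real (r ^ m) * Q x"
    using assms unfolding solid_harmonic_def by auto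
  have "((\<lambda>r. Q (r *\<^sub>R x)) has_derivative
      (\<lambda>h. \<Sum>i\<in>UNIV. ((h *\<^sub>R x) $ i) *\<^sub>R partial_derivative i Q (1 *\<^sub>R x))) (at 1)"
    by (rule has_derivative_compose[where f="\<lambda>r. r *\<^sub>R x"])
      (auto intro!: derivative_eq_intros has_derivative_partials cpoly_differentiable Q(1))
  then have 1: "((\<lambda>r. Q (r *\<^sub>R x)) has_vector_derivative (\<Sum>i\<in>UNIV. (x $ i) *\<^sub>R partial_derivative i Q x)) (at 1)"
    by (simp add: has_vector_derivative_def scaleR_right.sum)
  have "((\<lambda>r. r ^ m) has_real_derivative of_nat m) (at 1)"
    by (auto intro!: derivative_eq_intros)
  from has_vector_derivative_scaleR[OF this has_vector_derivative_const, of "Q x"]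
  have "((\<lambda>r. r ^ m *\<^sub>R Q x) has_vector_derivative (of_nat m * Q x)) (at 1)"
    by (simp add: scaleR_conv_of_real[where 'a=complex])
  then have "((\<lambda>r. Q (r *\<^sub>R x)) has_vector_derivative (of_nat m * Q x)) (at 1)"
    by (rule has_vector_derivative_transform_within_open[of _ _ _ "{0<..}"])
      (auto simp: Q(2) scaleR_conv_of_real[where 'a=complex])
  with 1 show ?thesis by (metis vector_derivative_unique_at)
qed

text \<open>Degree zero makes \<open>Q\<close> constant along open rays, and continuity at the
  origin gives the same value on all of them.\<close>

lemma solid_harmonic_0:
  assumes "solid_harmonic 0 Q"
  shows "Q x = Q 0"
proof -
  have Q: "cpoly Q" "\<And>r x. r > 0 \<Longrightarrow> Q (r *\<^sub>R x) = Q x"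
    using assms unfolding solid_harmonic_def by auto
  have "((\<lambda>r. Q (r *\<^sub>R x)) \<longlongrightarrow> Q (0 *\<^sub>R x)) (at_right 0)"
    using cpoly_continuous[OF Q(1)]
    by (intro isCont_tendsto_compose[of _ Q] tendsto_intros)
      (auto simp: continuous_on_eq_continuous_at)
  moreover have "\<forall>\<^sub>F r in at_right 0. Q (r *\<^sub>R x) = Q x"
    using Q(2) by (auto simp: eventually_at_filter)
  ultimately have "((\<lambda>r::real. Q x) \<longlongrightarrow> Q 0) (at_right 0)"
    using tendsto_cong by fastforce
  then show ?thesis
    by (simp add: tendsto_const_iff)
qed

lemma solid_harmonic_Suc_0: "solid_harmonic (Suc m) Q \<Longrightarrow> Q 0 = 0"
  
proof -
  assume "solid_harmonic (Suc m) Q"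
  then have "Q (2 *\<^sub>R 0) = of_real (2 ^ Suc m) * Q 0"
    unfolding solid_harmonic_def by (metis zero_less_numeral)
  moreover have "(2::complex) ^ Suc m \<noteq> 1"
    by (metis norm_numeral norm_one norm_power one_less_numeral_iff one_less_power semiring_norm(76)
        zero_less_Suc less_irrefl)
  ultimately show ?thesis by simp
qed

text \<open>\<open>sphere_inner\<close> conjugates its second argument, so the polynomial that gets
  integrated against \<open>u\<close> is the conjugate of the one representing
  \<open>H\<close>.\<close>

lemma spherical_harmonic_cnj_solid:
  assumes "spherical_harmonic m H"
  obtains Q where "solid_harmonic m Q" "\<And>\<theta>. \<theta> \<in> sphere 0 1 \<Longrightarrow> cnj (H \<theta>) = Q \<theta>"
proof -
  obtain P where P: "homogeneous_polynomial m P" "\<And>x. laplacian P x = 0"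
    "\<And>\<theta>. \<theta> \<in> sphere 0 1 \<Longrightarrow> H \<theta> = P \<theta>"
    using assms unfolding spherical_harmonic_def by blast
  obtain c where
    c: "\<And>x. P x = (\<Sum>\<alpha> | (\<Sum>i\<in>UNIV. \<alpha> i) = m. c \<alpha> * (\<Prod>i\<in>UNIV. of_real (x $ i) ^ \<alpha> i))"
    using P(1) unfolding homogeneous_polynomial_def by blast
  have cp: "cpoly P" by (rule homogeneous_polynomial_cpoly[OF P(1)])
  have pd: "partial_derivative i (\<lambda>x. cnj (P x)) = (\<lambda>x. cnj (partial_derivative i P x))"
    if "cpoly P" for P i
    using partial_derivative_eq[OF has_derivative_cnj[OF has_derivative_partials[OF cpoly_differentiable[OF that]]], of i]
    by auto
  have "laplacian (\<lambda>x. cnj (P x)) x = cnj (laplacian P x)" for x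
    by (simp add: laplacian_def pd cp cpoly_partial_derivative)
  moreover have "P (r *\<^sub>R x) = of_real (r ^ m) * P x" for r x
  proof -
    have "(\<Prod>i\<in>UNIV. complex_of_real ((r *\<^sub>R x) $ i) ^ \<alpha> i) =
        of_real (r ^ m) * (\<Prod>i\<in>UNIV. of_real (x $ i) ^ \<alpha> i)" if "(\<Sum>i\<in>UNIV. \<alpha> i) = m" for \<alpha>
      using that by (simp add: power_mult_distrib prod.distrib power_sum[symmetric])
    then show ?thesis
      unfolding c sum_distrib_left by (intro sum.cong) (auto simp: mult_ac)
  qed
  ultimately have "solid_harmonic m (\<lambda>x. cnj (P x))"
    using P(2) by (auto simp: solid_harmonic_def cpoly_cnj cp)
  then show thesis using P(3) by (intro that[of "\<lambda>x. cnj (P x)"]) auto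
qed

subsection \<open>Spherical means against solid harmonics\<close>

lemma continuous_on_sphere_scaled:
  fixes u :: "'a::euclidean_space \<Rightarrow> 'b::topological_space"
  assumes "continuous_on UNIV u"
  shows "continuous_on S (\<lambda>\<theta>. u (x + r *\<^sub>R \<theta>))" "continuous_on S (\<lambda>\<theta>. u (r *\<^sub>R \<theta>))"
  by (intro continuous_on_compose2[OF assms] continuous_intros subset_UNIV)+

lemma radial_mean_sum:
  fixes v :: "'i \<Rightarrow> 'a::euclidean_space \<Rightarrow> 'b::{banach, second_countable_topology}"
  assumes "\<And>i. i \<in> I \<Longrightarrow> continuous_on UNIV (v i)"
  shows "radial_mean (\<lambda>x. \<Sum>i\<in>I. v i x) r = (\<Sum>i\<in>I. radial_mean (v i) r)"
proof -
  have "(LINT \<theta>|sphere_measure 0 1. (\<Sum>i\<in>I. v i (r *\<^sub>R \<theta>))) =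
      (\<Sum>i\<in>I. LINT \<theta>|sphere_measure 0 1. v i (r *\<^sub>R \<theta>))"
    by (rule Bochner_Integration.integral_sum)
      (intro sphere_integrable continuous_on_sphere_scaled assms)
  then show ?thesis by (simp add: radial_mean_def scaleR_right.sum)
qed

lemma radial_mean_divide:
  fixes v :: "'a::euclidean_space \<Rightarrow> complex"
  shows "radial_mean (\<lambda>x. v x / c) r = radial_mean v r / c"
  by (simp add: radial_mean_def divide_inverse)

lemma scaleR_divide_complex: "(r *\<^sub>R z) / c = r *\<^sub>R (z / c :: complex)"
  by (simp add: divide_inverse)

text \<open>Uniform continuity of \<open>h\<close> on a ball slightly larger than needed. The radius
  \<open>R = 0\<close> is included and yields the limits at the origin.\<close>

lemma isCont_sphere_integral:
  fixes h :: "'a::euclidean_space \<Rightarrow> 'b::{banach, second_countable_topology}"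
  assumes h: "continuous_on UNIV h"
  shows "isCont (\<lambda>r. LINT \<theta>|sphere_measure 0 1. h (r *\<^sub>R \<theta>)) R"
  unfolding continuous_at_eps_delta
proof (intro allI impI)
  fix e :: real assume e: "e > 0"
  let ?A = "sphere_area TYPE('a)"
  let ?I = "\<lambda>r. LINT \<theta>|sphere_measure 0 1. h (r *\<^sub>R \<theta>)"
  have A: "?A > 0" by (rule sphere_area_pos)
  have "uniformly_continuous_on (cball 0 (\<bar>R\<bar> + 1)) h"
    by (rule compact_uniformly_continuous) (use h continuous_on_subset in auto)
  \<comment> \<open>The factor 2 compensates for the integral bound being non-strict.\<close>
  moreover have "e / (2 * ?A) > 0" using e A by simp
  ultimately obtain d where d: "d > 0" "\<And>x y. norm x \<le> \<bar>R\<bar> + 1 \<Longrightarrow> norm y \<le> \<bar>R\<bar> + 1 \<Longrightarrow>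
      dist y x < d \<Longrightarrow> dist (h y) (h x) < e / (2 * ?A)"
    unfolding uniformly_continuous_on_def by auto
  have "dist (?I r) (?I R) < e" if r: "dist r R < min d 1" for r
  proof -
    have "?I r - ?I R = (LINT \<theta>|sphere_measure 0 1. h (r *\<^sub>R \<theta>) - h (R *\<^sub>R \<theta>))"
      by (rule Bochner_Integration.integral_diff[symmetric])
        (intro sphere_integrable continuous_on_sphere_scaled h)+
    then have "dist (?I r) (?I R) = norm (LINT \<theta>|sphere_measure 0 1. h (r *\<^sub>R \<theta>) - h (R *\<^sub>R \<theta>))"
      by (simp add: dist_norm)
    also have "\<dots> \<le> ?A * (e / (2 * ?A))"
    proof (rule sphere_integral_norm_le)
      show "continuous_on (sphere 0 1) (\<lambda>\<theta>. h (r *\<^sub>R \<theta>) - h (R *\<^sub>R \<theta>))"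
        by (intro continuous_intros continuous_on_sphere_scaled h)
      show "norm (h (r *\<^sub>R \<theta>) - h (R *\<^sub>R \<theta>)) \<le> e / (2 * ?A)" if "norm \<theta> = 1" for \<theta>
      proof -
        have "dist (r *\<^sub>R \<theta>) (R *\<^sub>R \<theta>) < d" "norm (r *\<^sub>R \<theta>) \<le> \<bar>R\<bar> + 1"
          using r that by (auto simp: dist_norm simp flip: scaleR_diff_left)
        then show ?thesis
          using d(2)[of "R *\<^sub>R \<theta>" "r *\<^sub>R \<theta>"] that by (simp add: dist_norm less_imp_le)
      qed
    qed
    also have "\<dots> < e" using e A by simp
    finally show ?thesis .
  qed
  then show "\<exists>d>0. \<forall>r. dist r R < d \<longrightarrow> dist (?I r) (?I R) < e"
    using d(1) by (intro exI[of _ "min d 1"]) auto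
qed

lemma sphere_integral_tendsto_0:
  fixes h :: "'a::euclidean_space \<Rightarrow> 'b::{banach, second_countable_topology}"
  assumes "continuous_on UNIV h"
  shows "((\<lambda>r. LINT \<theta>|sphere_measure 0 1. h (r *\<^sub>R \<theta>)) \<longlongrightarrow> sphere_area TYPE('a) *\<^sub>R h 0) (at_right 0)"
  using isCont_sphere_integral[OF assms, of 0]
  by (auto simp: isCont_def sphere_area_def intro: tendsto_within_subset)

text \<open>For \<open>Q\<close> homogeneous of degree \<open>m\<close>, this is the integrand obtained from \<open>Q u\<close> by \<open>j\<close> steps of
  \<open>D\<close>; in particular \<open>harmonic_transfer m m Q u = Q(\<partial>) u\<close>.\<close>

primrec harmonic_transfer ::
    "nat \<Rightarrow> nat \<Rightarrow> (real ^ 'n \<Rightarrow> complex) \<Rightarrow> (real ^ 'n \<Rightarrow> complex) \<Rightarrow> real ^ 'n \<Rightarrow> complex" where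
  "harmonic_transfer 0 m Q u = (\<lambda>x. Q x * u x)"
| "harmonic_transfer (Suc j) m Q u = (\<lambda>x.
     (\<Sum>i\<in>UNIV. harmonic_transfer j (m - 1) (partial_derivative i Q) (partial_derivative i u) x) / of_nat m)"

lemma harmonic_transfer_continuous:
  "cpoly Q \<Longrightarrow> C_infinity u \<Longrightarrow> continuous_on UNIV (harmonic_transfer j m Q u)"
proof (induction j arbitrary: m Q u)
  case 0
  then show ?case
    unfolding harmonic_transfer.simps
    by (intro continuous_intros cpoly_continuous C_infinity_continuous)
next
  case (Suc j)
  have "continuous_on UNIV (harmonic_transfer j (m - 1) (partial_derivative i Q) (partial_derivative i u))" for i
    using Suc by (intro Suc.IH cpoly_partial_derivative C_infinity_partial_derivative)
  then show ?case
    unfolding harmonic_transfer.simps divide_inverse by (intro continuous_intros)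
qed

text \<open>Euler's identity writes \<open>m Q u\<close> as the sum of the products of coordinates
  with \<open>v i\<close>, to which the divergence theorem applies termwise. The divergence of
  \<open>v\<close> is the sum of products of first partials plus \<open>u\<close> times the
  Laplacian of \<open>Q\<close>, and the latter vanishes.\<close>

lemma radial_mean_transfer_0_derivative:
  fixes Q u :: "real ^ 'n \<Rightarrow> complex"
  assumes Q: "solid_harmonic m Q" and m: "m > 0" and u: "C_infinity u"
    and R: "R > 0" and n: "CARD('n) \<ge> 2"
  shows "(radial_mean (harmonic_transfer 0 m Q u) has_vector_derivative
    R *\<^sub>R radial_mean (harmonic_transfer 1 m Q u) R) (at R)"
proof -
  let ?pd = "partial_derivative"
  define v where "v i x = ?pd i Q x * u x" for i x
  define dv where "dv i x = ?pd i Q x * ?pd i u x + ?pd i (?pd i Q) x * u x" for i x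
  have cQ: "cpoly Q" and lap: "\<And>x. laplacian Q x = 0"
    using Q by (auto simp: solid_harmonic_def)
  note smooth = cQ u cpoly_partial_derivative[OF cQ] C_infinity_partial_derivative[OF u]
    cpoly_partial_derivative[OF cpoly_partial_derivative[OF cQ]]
  have vdiff: "v i differentiable (at x)" for i x
    using smooth unfolding v_def
    by (intro differentiable_mult) (simp_all add: cpoly_differentiable C_infinity_differentiable)
  have dv: "?pd i (v i) = dv i" for i
    using smooth unfolding v_def dv_def fun_eq_iff
    by (simp add: partial_derivative_mult cpoly_differentiable C_infinity_differentiable)
  have dvc: "continuous_on UNIV (dv i)" and vc: "continuous_on UNIV (v i)" for i
    using smooth unfolding v_def dv_def
    by (simp_all add: continuous_intros cpoly_continuous C_infinity_continuous)
  have "(radial_mean (\<lambda>x. (x \<bullet> axis i 1) *\<^sub>R v i x) has_vector_derivative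
      R *\<^sub>R radial_mean (dv i) R) (at R)" for i
    using radial_mean_has_vector_derivative[OF has_derivative_partials[OF vdiff[of i]], of "axis i 1" R]
      dvc[of i] R n by (simp add: dv eta_contract_eq)
  then have "((\<lambda>r. \<Sum>i\<in>UNIV. radial_mean (\<lambda>x. (x $ i) *\<^sub>R v i x) r) has_vector_derivative
      (\<Sum>i\<in>UNIV. R *\<^sub>R radial_mean (dv i) R)) (at R)"
    by (intro has_vector_derivative_sum) (simp add: inner_axis)
  then have *: "((\<lambda>r. (\<Sum>i\<in>UNIV. radial_mean (\<lambda>x. (x $ i) *\<^sub>R v i x) r) / of_nat m) has_vector_derivative
      (\<Sum>i\<in>UNIV. R *\<^sub>R radial_mean (dv i) R) / of_nat m) (at R)"
    by (rule has_vector_derivative_divide)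
  have "harmonic_transfer 0 m Q u = (\<lambda>x. (\<Sum>i\<in>UNIV. (x $ i) *\<^sub>R v i x) / of_nat m)"
  proof
    fix x
    have "(\<Sum>i\<in>UNIV. (x $ i) *\<^sub>R v i x) = of_nat m * Q x * u x"
      unfolding solid_harmonic_Euler[OF Q, of x] by (simp add: v_def sum_distrib_right)
    then show "harmonic_transfer 0 m Q u x = (\<Sum>i\<in>UNIV. (x $ i) *\<^sub>R v i x) / of_nat m"
      using m by simp
  qed
  then have lhs: "radial_mean (harmonic_transfer 0 m Q u) =
      (\<lambda>r. (\<Sum>i\<in>UNIV. radial_mean (\<lambda>x. (x $ i) *\<^sub>R v i x) r) / of_nat m)"
    by (simp add: fun_eq_iff radial_mean_divide, subst radial_mean_sum)
      (auto intro!: continuous_intros vc)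
  have "(\<Sum>i\<in>UNIV. dv i x) = (\<Sum>i\<in>UNIV. ?pd i Q x * ?pd i u x)" for x
    using lap[of x] by (simp add: dv_def sum.distrib laplacian_def flip: sum_distrib_right)
  then have "harmonic_transfer 1 m Q u = (\<lambda>x. (\<Sum>i\<in>UNIV. dv i x) / of_nat m)"
    by (simp add: fun_eq_iff)
  then have rhs: "R *\<^sub>R radial_mean (harmonic_transfer 1 m Q u) R =
      (\<Sum>i\<in>UNIV. R *\<^sub>R radial_mean (dv i) R) / of_nat m"
    using dvc by (simp add: radial_mean_divide radial_mean_sum scaleR_divide_complex flip: scaleR_right.sum)
  show ?thesis
    unfolding lhs rhs by (rule *)
qed

text \<open>Induction on \<open>j\<close>: after one step the integrand is a sum of terms of the
  same kind for the partial derivatives of \<open>Q\<close> and \<open>u\<close>, with the degree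
  lowered by one. The condition \<open>j < m\<close> leaves positive degree for one more
  step.\<close>

theorem radial_mean_transfer_derivative:
  fixes Q u :: "real ^ 'n \<Rightarrow> complex"
  assumes Q: "solid_harmonic m Q" and j: "j < m" and u: "C_infinity u"
    and R: "R > 0" and n: "CARD('n) \<ge> 2"
  shows "(radial_mean (harmonic_transfer j m Q u) has_vector_derivative
    R *\<^sub>R radial_mean (harmonic_transfer (Suc j) m Q u) R) (at R)"
  using Q j u
proof (induction j arbitrary: m Q u)
  case 0
  then show ?case
    using radial_mean_transfer_0_derivative[OF _ _ _ R n, of m Q u] by simp
next
  case (Suc j)
  obtain k where m: "m = Suc k" using Suc.prems(2) by (cases m) auto
  let ?h = "\<lambda>j i. harmonic_transfer j k (partial_derivative i Q) (partial_derivative i u)"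
  have "cpoly Q" using Suc.prems(1) by (simp add: solid_harmonic_def)
  then have cont: "continuous_on UNIV (?h j i)" for j i
    using Suc.prems(3)
    by (intro harmonic_transfer_continuous cpoly_partial_derivative C_infinity_partial_derivative)
  have *: "radial_mean (harmonic_transfer (Suc j) m Q u) =
      (\<lambda>r. (\<Sum>i\<in>UNIV. radial_mean (?h j i) r) / of_nat m)" for j
    using radial_mean_sum[of UNIV "?h j", OF cont]
    by (simp add: fun_eq_iff radial_mean_divide m)
  have "(radial_mean (?h j i) has_vector_derivative R *\<^sub>R radial_mean (?h (Suc j) i) R) (at R)" for i
    using Suc.prems m by (intro Suc.IH solid_harmonic_partial_derivative C_infinity_partial_derivative) auto
  then have "((\<lambda>r. (\<Sum>i\<in>UNIV. radial_mean (?h j i) r) / of_nat m) has_vector_derivative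
     (\<Sum>i\<in>UNIV. R *\<^sub>R radial_mean (?h (Suc j) i) R) / of_nat m) (at R)"
    by (intro has_vector_derivative_divide has_vector_derivative_sum)
  then show ?case
    unfolding * by (simp only: scaleR_right.sum[symmetric] scaleR_divide_complex)
qed

section \<open>Limits of radial means at the origin\<close>

lemma lhopital_right_0_complex:
  fixes f f' :: "real \<Rightarrow> complex" and g g' :: "real \<Rightarrow> real"
  assumes f0: "(f \<longlongrightarrow> 0) (at_right 0)" and g0: "(g \<longlongrightarrow> 0) (at_right 0)"
    and g: "\<And>r. r > 0 \<Longrightarrow> g r \<noteq> 0" "\<And>r. r > 0 \<Longrightarrow> g' r \<noteq> 0"
    and df: "\<And>r. r > 0 \<Longrightarrow> (f has_vector_derivative f' r) (at r)"
    and dg: "\<And>r. r > 0 \<Longrightarrow> (g has_real_derivative g' r) (at r)"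
    and lim: "((\<lambda>r. f' r / of_real (g' r)) \<longlongrightarrow> L) (at_right 0)"
  shows "((\<lambda>r. f r / of_real (g r)) \<longlongrightarrow> L) (at_right 0)"
proof -
  have ev: "\<forall>\<^sub>F r in at_right 0. P r" if "\<And>r. r > 0 \<Longrightarrow> P r" for P :: "real \<Rightarrow> bool"
    using that by (auto simp: eventually_at_filter)
  \<comment> \<open>The denominator is real, so real and imaginary parts can be treated separately
    by the real rule.\<close>
  have "((\<lambda>r. Re (f r) / g r) \<longlongrightarrow> Re L) (at_right 0)"
  proof (rule lhopital_right_0[where f'="\<lambda>r. Re (f' r)" and g'=g'])
    show "((\<lambda>r. Re (f r)) \<longlongrightarrow> 0) (at_right 0)" using tendsto_Re[OF f0] by simp
    show "((\<lambda>r. Re (f' r) / g' r) \<longlongrightarrow> Re L) (at_right 0)" using tendsto_Re[OF lim] by simp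
    show "\<forall>\<^sub>F r in at_right 0. ((\<lambda>r. Re (f r)) has_real_derivative Re (f' r)) (at r)"
      using df by (intro ev) (auto simp: has_vector_derivative_complex_iff)
  qed (use g0 g dg ev in auto)
  moreover have "((\<lambda>r. Im (f r) / g r) \<longlongrightarrow> Im L) (at_right 0)"
  proof (rule lhopital_right_0[where f'="\<lambda>r. Im (f' r)" and g'=g'])
    show "((\<lambda>r. Im (f r)) \<longlongrightarrow> 0) (at_right 0)" using tendsto_Im[OF f0] by simp
    show "((\<lambda>r. Im (f' r) / g' r) \<longlongrightarrow> Im L) (at_right 0)" using tendsto_Im[OF lim] by simp
    show "\<forall>\<^sub>F r in at_right 0. ((\<lambda>r. Im (f r)) has_real_derivative Im (f' r)) (at r)"
      using df by (intro ev) (auto simp: has_vector_derivative_complex_iff)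
  qed (use g0 g dg ev in auto)
  ultimately show ?thesis
    by (simp add: tendsto_complex_iff)
qed

text \<open>One application of L'Hopital's rule per degree. Differentiating the power in the
  denominator brings down its exponent, and these exponents accumulate to the product
  \<open>n (n + 2) ... (n + 2 (m - 1))\<close> that appears in \<open>k_coeff\<close>.\<close>

theorem radial_mean_limit:
  fixes Q u :: "real ^ 'n \<Rightarrow> complex"
  assumes Q: "solid_harmonic m Q" and u: "C_infinity u" and n: "CARD('n) \<ge> 2"
  shows "((\<lambda>r. radial_mean (\<lambda>x. Q x * u x) r / of_real (r ^ (CARD('n) - 2 + 2 * m))) \<longlongrightarrow>
    of_real (sphere_area TYPE(real ^ 'n) / (\<Prod>j<m. real (CARD('n) + 2 * j))) * harmonic_transfer m m Q u 0)
    (at_right 0)"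
  using Q u
proof (induction m arbitrary: Q u)
  case 0
  have "continuous_on UNIV (\<lambda>x. Q x * u x)"
    using 0 by (intro continuous_intros cpoly_continuous C_infinity_continuous) (auto simp: solid_harmonic_def)
  from sphere_integral_tendsto_0[OF this]
  have "((\<lambda>r. LINT \<theta>|sphere_measure 0 1. Q (r *\<^sub>R \<theta>) * u (r *\<^sub>R \<theta>)) \<longlongrightarrow>
      sphere_area TYPE(real ^ 'n) *\<^sub>R (Q 0 * u 0)) (at_right 0)" .
  moreover have "\<forall>\<^sub>F r in at_right 0. (LINT \<theta>|sphere_measure 0 1. Q (r *\<^sub>R \<theta>) * u (r *\<^sub>R \<theta>)) =
      radial_mean (\<lambda>x. Q x * u x) r / of_real (r ^ (CARD('n) - 2 + 2 * 0))"
    by (auto simp: eventually_at_filter radial_mean_def scaleR_conv_of_real[where 'a=complex])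
  ultimately show ?case
    using tendsto_cong by (fastforce simp: scaleR_conv_of_real[where 'a=complex])
next
  case (Suc m)
  let ?n = "CARD('n)" and ?k = "CARD('n) - 2 + 2 * m"
  let ?A = "sphere_area TYPE(real ^ 'n)"
  let ?P = "\<lambda>m. \<Prod>j<m. real (CARD('n) + 2 * j)"
  let ?pd = "partial_derivative"
  have cQ: "cpoly Q" using Suc.prems by (simp add: solid_harmonic_def)
  have "continuous_on UNIV (\<lambda>x. Q x * u x)"
    using cQ Suc.prems by (intro continuous_intros cpoly_continuous C_infinity_continuous)
  \<comment> \<open>The numerator tends to zero because \<open>Q\<close> vanishes at the origin in
    positive degree; the power of \<open>r\<close> in front would not suffice, being constant in
    dimension 2.\<close>
  from sphere_integral_tendsto_0[OF this]
  have "((\<lambda>r. LINT \<theta>|sphere_measure 0 1. Q (r *\<^sub>R \<theta>) * u (r *\<^sub>R \<theta>)) \<longlongrightarrow> 0) (at_right 0)"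
    by (simp add: solid_harmonic_Suc_0[OF Suc.prems(1)])
  moreover have "((\<lambda>r::real. r ^ (CARD('n) - 2)) \<longlongrightarrow> 0 ^ (CARD('n) - 2)) (at_right 0)"
    by (intro tendsto_intros)
  ultimately have f0: "(radial_mean (\<lambda>x. Q x * u x) \<longlongrightarrow> 0) (at_right 0)"
    unfolding radial_mean_def[abs_def] using tendsto_scaleR by fastforce
  have df: "(radial_mean (\<lambda>x. Q x * u x) has_vector_derivative
      r *\<^sub>R (\<Sum>i\<in>UNIV. radial_mean (\<lambda>x. ?pd i Q x * ?pd i u x) r) / of_nat (Suc m)) (at r)"
    if r: "r > 0" for r
  proof -
    have "continuous_on UNIV (\<lambda>x. ?pd i Q x * ?pd i u x)" for i
      using cQ Suc.prems by (intro continuous_intros cpoly_continuous C_infinity_continuous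
          cpoly_partial_derivative C_infinity_partial_derivative)
    then have "radial_mean (harmonic_transfer 1 (Suc m) Q u) r =
        (\<Sum>i\<in>UNIV. radial_mean (\<lambda>x. ?pd i Q x * ?pd i u x) r) / of_nat (Suc m)"
      by (simp add: radial_mean_divide radial_mean_sum)
    then show ?thesis
      using radial_mean_transfer_0_derivative[OF Suc.prems(1) _ Suc.prems(2) r n]
      by (simp add: scaleR_divide_complex)
  qed
  \<comment> \<open>\<open>Suc m\<close> is the divisor in the recursion of
    \<open>harmonic_transfer\<close>, and \<open>?n + 2 * m\<close> is the new factor of the
    product.\<close>
  have nz: "complex_of_real (real (Suc m) * real (?n + 2 * m)) \<noteq> 0"
    unfolding of_real_eq_0_iff using n by simp
  have "((\<lambda>r. (\<Sum>i\<in>UNIV. radial_mean (\<lambda>x. ?pd i Q x * ?pd i u x) r / of_real (r ^ ?k))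
       / of_real (real (Suc m) * real (?n + 2 * m))) \<longlongrightarrow>
     (\<Sum>i\<in>UNIV. of_real (?A / ?P m) * harmonic_transfer m m (?pd i Q) (?pd i u) 0)
       / of_real (real (Suc m) * real (?n + 2 * m))) (at_right 0)"
    using Suc.prems
    by (intro tendsto_divide[OF tendsto_sum tendsto_const nz] Suc.IH
        solid_harmonic_partial_derivative C_infinity_partial_derivative)
  also have "(\<Sum>i\<in>UNIV. of_real (?A / ?P m) * harmonic_transfer m m (?pd i Q) (?pd i u) 0)
       / of_real (real (Suc m) * real (?n + 2 * m)) =
     of_real (?A / ?P (Suc m)) * harmonic_transfer (Suc m) (Suc m) Q u 0"
    unfolding sum_distrib_left[symmetric] by (simp add: field_simps)
  finally have lim: "((\<lambda>r. (\<Sum>i\<in>UNIV. radial_mean (\<lambda>x. ?pd i Q x * ?pd i u x) r / of_real (r ^ ?k))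
       / of_real (real (Suc m) * real (?n + 2 * m))) \<longlongrightarrow>
     of_real (?A / ?P (Suc m)) * harmonic_transfer (Suc m) (Suc m) Q u 0) (at_right 0)" .
  have "\<forall>\<^sub>F r in at_right 0. (\<Sum>i\<in>UNIV. radial_mean (\<lambda>x. ?pd i Q x * ?pd i u x) r / of_real (r ^ ?k))
       / of_real (real (Suc m) * real (?n + 2 * m)) =
     r *\<^sub>R (\<Sum>i\<in>UNIV. radial_mean (\<lambda>x. ?pd i Q x * ?pd i u x) r) / of_nat (Suc m) /
     of_real (real (?n + 2 * m) * r ^ Suc ?k)"
  proof (subst eventually_at_right_field, intro exI[of _ 1] conjI allI impI)
    fix r :: real assume r: "0 < r" 
    define s where "s = (\<Sum>i\<in>UNIV. radial_mean (\<lambda>x. ?pd i Q x * ?pd i u x) r)"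
    have "s / of_real (r ^ ?k) / of_real (real (Suc m) * real (?n + 2 * m)) =
      of_real r * s / of_nat (Suc m) / of_real (real (?n + 2 * m) * r ^ Suc ?k)"
    proof -
      have gen: "s / a / (b * c) = \<rho> * s / b / (c * (\<rho> * a))" if "\<rho> \<noteq> 0" for a b c \<rho> :: complex
        using that by (cases "a = 0 \<or> b = 0 \<or> c = 0") (auto simp: divide_simps)
      show ?thesis
        using gen[of "of_real r"] r by (simp only: of_real_mult power_Suc of_real_of_nat_eq) simp
    qed
    then show "(\<Sum>i\<in>UNIV. radial_mean (\<lambda>x. ?pd i Q x * ?pd i u x) r / of_real (r ^ ?k))
       / of_real (real (Suc m) * real (?n + 2 * m)) =
     r *\<^sub>R (\<Sum>i\<in>UNIV. radial_mean (\<lambda>x. ?pd i Q x * ?pd i u x) r) / of_nat (Suc m) /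
     of_real (real (?n + 2 * m) * r ^ Suc ?k)"
      unfolding sum_divide_distrib[symmetric] s_def[symmetric]
      by (simp add: scaleR_conv_of_real[where 'a=complex])
  qed auto
  then have lim': "((\<lambda>r. r *\<^sub>R (\<Sum>i\<in>UNIV. radial_mean (\<lambda>x. ?pd i Q x * ?pd i u x) r) / of_nat (Suc m) /
      of_real (real (?n + 2 * m) * r ^ Suc ?k)) \<longlongrightarrow>
     of_real (?A / ?P (Suc m)) * harmonic_transfer (Suc m) (Suc m) Q u 0) (at_right 0)"
    by (rule Lim_transform_eventually[OF lim])
  \<comment> \<open>Since the dimension is at least 2, the exponent of the denominator is exactly
    \<open>?n + 2 * m\<close>, the factor that its derivative produces.\<close>
  have k: "CARD('n) - 2 + 2 * Suc m = Suc (Suc ?k)" "real (?n + 2 * m) = real (Suc (Suc ?k))"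
    using n by auto
  show ?case
  proof (rule lhopital_right_0_complex[OF f0 _ _ _ df _ lim'])
    show "((\<lambda>r::real. r ^ (CARD('n) - 2 + 2 * Suc m)) \<longlongrightarrow> 0) (at_right 0)"
      unfolding k by (auto intro!: tendsto_eq_intros)
    fix r :: real assume r: "r > 0"
    show "r ^ (CARD('n) - 2 + 2 * Suc m) \<noteq> 0" using r by simp
    show "real (?n + 2 * m) * r ^ Suc ?k \<noteq> 0" using r n by simp
    show "((\<lambda>r. r ^ (CARD('n) - 2 + 2 * Suc m)) has_real_derivative real (?n + 2 * m) * r ^ Suc ?k) (at r)"
      unfolding k using DERIV_pow[of "Suc (Suc ?k)" r] by simp
  qed
qed

subsection \<open>Smoothness of the spherical mean transform\<close>

text \<open>Uniform continuity of the gradient on a compact ball makes the first-order Taylor error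
  uniform in the base point, as needed to differentiate under the sphere integral.\<close>

lemma C_infinity_uniform_linearization:
  fixes f :: "real ^ 'n \<Rightarrow> complex"
  assumes f: "C_infinity f" and e: "e > 0"
  shows "\<exists>d>0. \<forall>y h. norm y \<le> \<rho> \<and> norm h < d \<longrightarrow>
    norm (f (y + h) - f y - (\<Sum>i\<in>UNIV. (h $ i) *\<^sub>R partial_derivative i f y)) \<le> e * norm h"
proof -
  let ?D = "\<lambda>x h. \<Sum>i\<in>UNIV. (h $ i) *\<^sub>R partial_derivative i f x"
  define g where "g x = (\<chi> i. partial_derivative i f x)" for x
  have g: "continuous_on UNIV g"
    unfolding g_def by (intro continuous_on_vec_lambda C_infinity_continuous C_infinity_partial_derivative f)
  have "uniformly_continuous_on (cball 0 (\<rho> + 1)) g"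
    by (rule compact_uniformly_continuous) (use g continuous_on_subset in auto)
  \<comment> \<open>The derivative is a sum over all coordinates, so each partial derivative gets an
    equal share of the tolerance.\<close>
  moreover have "e / CARD('n) > 0" using e by simp
  ultimately obtain d where d: "d > 0" "\<And>x y. norm x \<le> \<rho> + 1 \<Longrightarrow> norm y \<le> \<rho> + 1 \<Longrightarrow>
      dist y x < d \<Longrightarrow> dist (g y) (g x) < e / CARD('n)"
    unfolding uniformly_continuous_on_def by auto
  have "norm (f (y + h) - f y - ?D y h) \<le> e * norm h"
    if y: "norm y \<le> \<rho>" and h: "norm h < min d 1" for y h
  proof -
    have "norm (f (y + h) - f y - ?D y (y + h - y)) \<le> norm (y + h - y) * e"
    proof (rule differentiable_bound_linearization[where S="ball y (min d 1)"])
      show "y + t *\<^sub>R (y + h - y) \<in> ball y (min d 1)" if "t \<in> {0..1}" for t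
      proof -
        have "norm (t *\<^sub>R h) \<le> norm h" using that by (simp add: mult_left_le_one_le)
        then show ?thesis using h by (simp add: dist_norm)
      qed
      show "(f has_derivative ?D x) (at x within ball y (min d 1))" for x
        by (rule has_derivative_at_withinI[OF has_derivative_partials[OF C_infinity_differentiable[OF f]]])
      show "y \<in> ball y (min d 1)" using d by simp
      show "onorm (?D x - ?D y) \<le> e" if x: "x \<in> ball y (min d 1)" for x
      proof (rule onorm_le)
        fix k :: "real ^ 'n"
        have "norm x \<le> \<rho> + 1"
          using x y norm_triangle_ineq2[of x y] by (simp add: dist_norm norm_minus_commute)
        then have "dist (g x) (g y) < e / CARD('n)"
          using d(2)[of y x] x y by (simp add: dist_commute)
        then have comp: "norm (partial_derivative i f x - partial_derivative i f y) \<le> e / CARD('n)" for i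
          using Finite_Cartesian_Product.norm_nth_le[of "g x - g y" i] by (simp add: dist_norm g_def)
        have "(?D x - ?D y) k = (\<Sum>i\<in>UNIV. (k $ i) *\<^sub>R (partial_derivative i f x - partial_derivative i f y))"
          by (simp add: scaleR_diff_right sum_subtractf)
        also have "norm \<dots> \<le> (\<Sum>i\<in>(UNIV::'n set). norm k * (e / CARD('n)))"
          by (rule sum_norm_le, unfold norm_scaleR real_norm_def, rule mult_mono)
            (use comp component_le_norm_cart in auto)
        also have "\<dots> = e * norm k" by simp
        finally show "norm ((?D x - ?D y) k) \<le> e * norm k" .
      qed
    qed
    then show ?thesis by (simp add: mult.commute)
  qed
  then show ?thesis using d(1) by (intro exI[of _ "min d 1"]) auto
qed

text \<open>The uniform linearization of \<open>f\<close> is integrated over the unit sphere; this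
  costs the factor \<open>?A\<close>, hence the tolerance \<open>e / ?A\<close>.\<close>

theorem spherical_mean_has_derivative:
  fixes f :: "real ^ 'n \<Rightarrow> complex"
  assumes f: "C_infinity f" and t: "t > 0"
  shows "((\<lambda>x. spherical_mean f x t) has_derivative
    (\<lambda>h. \<Sum>i\<in>UNIV. (h $ i) *\<^sub>R spherical_mean (partial_derivative i f) x t)) (at x)"
proof -
  let ?A = "sphere_area TYPE(real ^ 'n)"
  let ?S = "\<lambda>g x. LINT \<theta>|sphere_measure 0 1. g (x + t *\<^sub>R \<theta>) :: complex"
  let ?pd = "partial_derivative"
  have A: "?A > 0" by (rule sphere_area_pos)
  have cont: "continuous_on UNIV f" "continuous_on UNIV (?pd i f)" for i
    using f by (simp_all add: C_infinity_continuous C_infinity_partial_derivative)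
  have "(?S f has_derivative (\<lambda>h. \<Sum>i\<in>UNIV. (h $ i) *\<^sub>R ?S (?pd i f) x)) (at x)"
    unfolding has_derivative_at_alt
  proof (intro conjI allI impI)
    show "bounded_linear (\<lambda>h. \<Sum>i\<in>UNIV. (h $ i) *\<^sub>R ?S (?pd i f) x)"
      by (intro bounded_linear_sum bounded_linear_scaleR_const bounded_linear_vec_nth)
    fix e :: real assume e: "e > 0"
    then have "e / ?A > 0" using A by simp
    \<comment> \<open>This radius covers the whole sphere of radius \<open>t\<close> about
      \<open>x\<close>.\<close>
    from C_infinity_uniform_linearization[OF f this, of "norm x + t"]
    obtain d where d: "d > 0" "\<And>y h. norm y \<le> norm x + t \<Longrightarrow> norm h < d \<Longrightarrow>
        norm (f (y + h) - f y - (\<Sum>i\<in>UNIV. (h $ i) *\<^sub>R ?pd i f y)) \<le> e / ?A * norm h"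
      by blast
    have "norm (?S f z - ?S f x - (\<Sum>i\<in>UNIV. ((z - x) $ i) *\<^sub>R ?S (?pd i f) x)) \<le> e * norm (z - x)"
      if z: "norm (z - x) < d" for z
    proof -
      define q where "q \<theta> = f (z + t *\<^sub>R \<theta>) - f (x + t *\<^sub>R \<theta>) -
          (\<Sum>i\<in>UNIV. ((z - x) $ i) *\<^sub>R ?pd i f (x + t *\<^sub>R \<theta>))" for \<theta>
      note int = sphere_integrable[OF continuous_on_sphere_scaled(1)[OF cont(1)]]
        sphere_integrable[OF continuous_on_sphere_scaled(1)[OF cont(2)]]
      have "?S f z - ?S f x - (\<Sum>i\<in>UNIV. ((z - x) $ i) *\<^sub>R ?S (?pd i f) x) =
          (LINT \<theta>|sphere_measure 0 1. q \<theta>)"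
        unfolding q_def using int
        by (simp add: Bochner_Integration.integral_sum Bochner_Integration.integral_diff
            Bochner_Integration.integrable_sum del: vector_minus_component)
      also have "norm \<dots> \<le> ?A * (e / ?A * norm (z - x))"
      proof (rule sphere_integral_norm_le)
        show "continuous_on (sphere 0 1) q"
          unfolding q_def by (intro continuous_intros continuous_on_sphere_scaled cont)
        show "norm (q \<theta>) \<le> e / ?A * norm (z - x)" if "norm \<theta> = 1" for \<theta>
        proof -
          have "norm (x + t *\<^sub>R \<theta>) \<le> norm x + t"
            using norm_triangle_ineq[of x "t *\<^sub>R \<theta>"] that t by simp
          from d(2)[OF this z] show ?thesis
            by (simp add: q_def algebra_simps)
        qed
      qed
      also have "\<dots> = e * norm (z - x)" using A by simp
      finally show ?thesis .
    qed
    then show "\<exists>d>0. \<forall>z. norm (z - x) < d \<longrightarrow>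
        norm (?S f z - ?S f x - (\<Sum>i\<in>UNIV. ((z - x) $ i) *\<^sub>R ?S (?pd i f) x)) \<le> e * norm (z - x)"
      using d(1) by blast
  qed
  from has_derivative_scaleR_right[OF this, of "1 / ?A"]
  show ?thesis
    unfolding spherical_mean_eq[OF t cont(1)] spherical_mean_eq[OF t cont(2)]
    by (simp add: scaleR_right.sum scaleR_conv_of_real[where 'a=complex] mult.commute sum_divide_distrib)
qed

lemma partial_derivative_spherical_mean:
  fixes f :: "real ^ 'n \<Rightarrow> complex"
  assumes "C_infinity f" "t > 0"
  shows "partial_derivative i (\<lambda>x. spherical_mean f x t) = (\<lambda>x. spherical_mean (partial_derivative i f) x t)"
  by (rule ext) (simp add: partial_derivative_eq[OF spherical_mean_has_derivative[OF assms]])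

lemma C_infinity_spherical_mean:
  fixes f :: "real ^ 'n \<Rightarrow> complex"
  assumes "C_infinity f" and t: "t > 0"
  shows "C_infinity (\<lambda>x. spherical_mean f x t)"
proof (rule C_infinity_coinduct[where X="\<lambda>g. \<exists>f. C_infinity f \<and> g = (\<lambda>x. spherical_mean f x t)"])
  show "\<exists>f'. C_infinity f' \<and> (\<lambda>x. spherical_mean f x t) = (\<lambda>x. spherical_mean f' x t)"
    using assms(1) by (intro exI[of _ f]) simp
next
  fix g :: "real ^ 'n \<Rightarrow> complex"
  assume "\<exists>f. C_infinity f \<and> g = (\<lambda>x. spherical_mean f x t)"
  then obtain f where f: "C_infinity f" and g: "g = (\<lambda>x. spherical_mean f x t)" by (elim exE conjE)
  show "g differentiable at x" for x
    unfolding g by (rule differentiableI[OF spherical_mean_has_derivative[OF f t]])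
  show "\<exists>f. C_infinity f \<and> partial_derivative i g = (\<lambda>x. spherical_mean f x t)" for i
    unfolding g partial_derivative_spherical_mean[OF f t]
    by (intro exI[of _ "partial_derivative i f"] conjI refl C_infinity_partial_derivative f)
qed

lemma spherical_mean_sum:
  fixes v :: "'i \<Rightarrow> 'a::euclidean_space \<Rightarrow> complex"
  assumes "\<And>i. i \<in> I \<Longrightarrow> continuous_on UNIV (v i)" and t: "t > 0"
  shows "spherical_mean (\<lambda>x. \<Sum>i\<in>I. v i x) x t = (\<Sum>i\<in>I. spherical_mean (v i) x t)"
proof -
  have "(LINT \<theta>|sphere_measure 0 1. (\<Sum>i\<in>I. v i (x + t *\<^sub>R \<theta>))) =
      (\<Sum>i\<in>I. LINT \<theta>|sphere_measure 0 1. v i (x + t *\<^sub>R \<theta>))"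
    by (rule Bochner_Integration.integral_sum)
      (rule sphere_integrable[OF continuous_on_sphere_scaled(1)[OF assms(1)]])
  moreover have "continuous_on UNIV (\<lambda>x. \<Sum>i\<in>I. v i x)"
    by (rule continuous_on_sum[OF assms(1)])
  ultimately show ?thesis
    unfolding spherical_mean_eq[OF t \<open>continuous_on UNIV (\<lambda>x. \<Sum>i\<in>I. v i x)\<close>]
    by (simp add: spherical_mean_eq[OF t assms(1)] sum_divide_distrib)
qed

lemma spherical_mean_divide:
  fixes v :: "'a::euclidean_space \<Rightarrow> complex"
  assumes v: "continuous_on UNIV v" and t: "t > 0"
  shows "spherical_mean (\<lambda>x. v x / c) x t = spherical_mean v x t / c"
proof -
  have vc: "continuous_on UNIV (\<lambda>x. v x / c)"
    unfolding divide_inverse by (rule continuous_on_mult_right[OF v])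
  show ?thesis
    unfolding spherical_mean_eq[OF t vc] spherical_mean_eq[OF t v] by simp
qed

text \<open>Spherical means commute with partial derivatives and finite sums. Exactly
  \<open>m\<close> steps are taken, so that the polynomial factor has become a constant and passes
  through the mean.\<close>

lemma harmonic_transfer_spherical_mean:
  fixes Q f :: "real ^ 'n \<Rightarrow> complex"
  assumes "solid_harmonic m Q" "C_infinity f" and t: "t > 0"
  shows "harmonic_transfer m m Q (\<lambda>x. spherical_mean f x t) x =
    spherical_mean (harmonic_transfer m m Q f) x t"
  using assms(1,2)
proof (induction m arbitrary: Q f)
  case 0
  have c: "continuous_on UNIV f" using 0 by (simp add: C_infinity_continuous)
  have "(\<lambda>x. Q x * f x) = (\<lambda>x. Q 0 * f x)"
    using solid_harmonic_0[OF 0(1)] by (intro ext) simp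
  then show ?case
    using solid_harmonic_0[OF 0(1), of x] continuous_on_mult_left[OF c]
    by (simp add: spherical_mean_eq[OF t] c)
next
  case (Suc m)
  let ?h = "\<lambda>i. harmonic_transfer m m (partial_derivative i Q) (partial_derivative i f)"
  have cont: "continuous_on UNIV (?h i)" for i
    using Suc.prems by (intro harmonic_transfer_continuous cpoly_partial_derivative
        C_infinity_partial_derivative) (auto simp: solid_harmonic_def)
  have "harmonic_transfer (Suc m) (Suc m) Q (\<lambda>x. spherical_mean f x t) x =
      (\<Sum>i\<in>UNIV. spherical_mean (?h i) x t) / of_nat (Suc m)"
    using Suc.IH[OF solid_harmonic_partial_derivative[OF Suc.prems(1)]
        C_infinity_partial_derivative[OF Suc.prems(2)]]
    by (simp add: partial_derivative_spherical_mean[OF Suc.prems(2) t])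
  also have "(\<Sum>i\<in>UNIV. spherical_mean (?h i) x t) = spherical_mean (\<lambda>x. \<Sum>i\<in>UNIV. ?h i x) x t"
    by (rule spherical_mean_sum[symmetric]) (use cont t in auto)
  also have "\<dots> / of_nat (Suc m) = spherical_mean (harmonic_transfer (Suc m) (Suc m) Q f) x t"
  proof -
    have "continuous_on UNIV (\<lambda>x. \<Sum>i\<in>UNIV. ?h i x)"
      by (rule continuous_on_sum[OF cont])
    then show ?thesis by (simp add: spherical_mean_divide[OF _ t])
  qed
  finally show ?case .
qed

subsection \<open>Inverting the radial derivative\<close>

text \<open>The kernel of Cauchy's formula for repeated integration, in the variable
  \<open>r\<^sup>2\<close>.\<close>

definition kernel_integral :: "(real \<Rightarrow> complex) \<Rightarrow> nat \<Rightarrow> real \<Rightarrow> real \<Rightarrow> complex" where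
  "kernel_integral e k a r = (LBINT \<tau>=a..r. e \<tau> * of_real ((r\<^sup>2 - \<tau>\<^sup>2) ^ k))"

lemma interval_integrable_positive:
  fixes e :: "real \<Rightarrow> 'b::{banach, second_countable_topology}" and a r :: real
  assumes "continuous_on {0<..} e" "a > 0" "r > 0"
  shows "interval_lebesgue_integrable lborel a r e"
proof (rule interval_integrable_isCont)
  fix x assume "min a r \<le> x"
  then have "x > 0" using assms by (auto simp: min_def split: if_splits)
  then show "isCont e x"
    using assms by (simp add: continuous_on_eq_continuous_at)
qed

text \<open>Splitting off one factor of the kernel moves the dependence on \<open>r\<close> out of
  the integral, so that the derivative in \<open>r\<close> needs no differentiation under the
  integral sign.\<close>

lemma kernel_integral_Suc:
  assumes e: "continuous_on {0<..} e" and a: "a > 0" and r: "r > 0"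
  shows "kernel_integral e (Suc k) a r = of_real (r\<^sup>2) * kernel_integral e k a r -
    kernel_integral (\<lambda>\<tau>. of_real (\<tau>\<^sup>2) * e \<tau>) k a r"
proof -
  let ?g = "\<lambda>\<tau>. e \<tau> * of_real ((r\<^sup>2 - \<tau>\<^sup>2) ^ k)"
  have int: "interval_lebesgue_integrable lborel a r (\<lambda>\<tau>. of_real (r\<^sup>2) * ?g \<tau>)"
    "interval_lebesgue_integrable lborel a r (\<lambda>\<tau>. of_real (\<tau>\<^sup>2) * e \<tau> * of_real ((r\<^sup>2 - \<tau>\<^sup>2) ^ k))"
    by (intro interval_integrable_positive continuous_intros e a r)+
  have "kernel_integral e (Suc k) a r =
      (LBINT \<tau>=a..r. of_real (r\<^sup>2) * ?g \<tau> - of_real (\<tau>\<^sup>2) * e \<tau> * of_real ((r\<^sup>2 - \<tau>\<^sup>2) ^ k))"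
    unfolding kernel_integral_def
    by (intro interval_integral_cong) (simp add: algebra_simps)
  also have "\<dots> = (LBINT \<tau>=a..r. of_real (r\<^sup>2) * ?g \<tau>) -
      (LBINT \<tau>=a..r. of_real (\<tau>\<^sup>2) * e \<tau> * of_real ((r\<^sup>2 - \<tau>\<^sup>2) ^ k))"
    by (rule interval_lebesgue_integral_diff(2)[OF int])
  finally show ?thesis
    by (simp add: kernel_integral_def)
qed

lemma kernel_integral_0_derivative:
  assumes e: "continuous_on {0<..} e" and a: "a > 0" and r: "r > 0"
  shows "(kernel_integral e 0 a has_vector_derivative e r) (at r)"
proof -
  \<comment> \<open>A compact interval of positive reals that contains \<open>a\<close> and has
    \<open>r\<close> in its interior, whichever of the two is larger.\<close>
  let ?c = "min a r / 2" and ?d = "max a r + 1"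
  have "((\<lambda>u. LBINT y=a..u. e y) has_vector_derivative e r) (at r within {?c..?d})"
    using a r by (intro interval_integral_FTC2 continuous_on_subset[OF e]) auto
  moreover have "at r within {?c..?d} = at r"
    using a r by (intro at_within_interior) auto
  ultimately show ?thesis
    by (simp add: kernel_integral_def[abs_def])
qed

text \<open>Product rule applied to the recurrence. In the base case the boundary terms cancel,
  since the kernel vanishes at the upper limit; in the induction step the recurrence recombines the
  terms.\<close>

lemma kernel_integral_Suc_derivative:
  assumes "continuous_on {0<..} e" and a: "a > 0" and r: "r > 0"
  shows "(kernel_integral e (Suc k) a has_vector_derivative
    of_real (2 * real (Suc k) * r) * kernel_integral e k a r) (at r)"
  using assms(1)
proof (induction k arbitrary: e)
  case (0 e)
  let ?e = "\<lambda>\<tau>. of_real (\<tau>\<^sup>2) * e \<tau>"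
  have e': "continuous_on {0<..} ?e" by (intro continuous_intros 0)
  have sq: "((\<lambda>r. complex_of_real (r\<^sup>2)) has_vector_derivative of_real (2 * r)) (at r)"
    by (rule has_vector_derivative_of_real) (auto intro!: derivative_eq_intros)
  have "((\<lambda>r. of_real (r\<^sup>2) * kernel_integral e 0 a r - kernel_integral ?e 0 a r) has_vector_derivative
      of_real (r\<^sup>2) * e r + of_real (2 * r) * kernel_integral e 0 a r - ?e r) (at r)"
    by (intro has_vector_derivative_diff has_vector_derivative_mult sq
        kernel_integral_0_derivative 0 e' a r)
  then have "(kernel_integral e (Suc 0) a has_vector_derivative
      of_real (r\<^sup>2) * e r + of_real (2 * r) * kernel_integral e 0 a r - ?e r) (at r)"
    by (rule has_vector_derivative_transform_within_open[of _ _ _ "{0<..}"])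
      (use r kernel_integral_Suc[OF 0 a] in auto)
  then show ?case by simp
next
  case (Suc k e)
  let ?e = "\<lambda>\<tau>. of_real (\<tau>\<^sup>2) * e \<tau>"
  have e': "continuous_on {0<..} ?e" by (intro continuous_intros Suc.prems)
  have sq: "((\<lambda>r. complex_of_real (r\<^sup>2)) has_vector_derivative of_real (2 * r)) (at r)"
    by (rule has_vector_derivative_of_real) (auto intro!: derivative_eq_intros)
  let ?c = "complex_of_real (2 * real (Suc k) * r)"
  have "((\<lambda>r. of_real (r\<^sup>2) * kernel_integral e (Suc k) a r - kernel_integral ?e (Suc k) a r) has_vector_derivative
      of_real (r\<^sup>2) * (?c * kernel_integral e k a r) + of_real (2 * r) * kernel_integral e (Suc k) a r
      - ?c * kernel_integral ?e k a r) (at r)"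
    by (intro has_vector_derivative_diff has_vector_derivative_mult sq Suc.IH Suc.prems e')
  then have "(kernel_integral e (Suc (Suc k)) a has_vector_derivative
      of_real (r\<^sup>2) * (?c * kernel_integral e k a r) + of_real (2 * r) * kernel_integral e (Suc k) a r
      - ?c * kernel_integral ?e k a r) (at r)"
    by (rule has_vector_derivative_transform_within_open[of _ _ _ "{0<..}"])
      (use r kernel_integral_Suc[OF Suc.prems a] in auto)
  moreover have "of_real (r\<^sup>2) * (?c * kernel_integral e k a r) + of_real (2 * r) * kernel_integral e (Suc k) a r
      - ?c * kernel_integral ?e k a r =
      of_real (2 * r) * kernel_integral e (Suc k) a r + ?c * kernel_integral e (Suc k) a r"
    unfolding kernel_integral_Suc[OF Suc.prems a r, of k] by (simp only: algebra_simps)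
  moreover have "\<dots> = of_real (2 * real (Suc (Suc k)) * r) * kernel_integral e (Suc k) a r"
    by (simp add: algebra_simps)
  ultimately show ?case by (simp only:)
qed

lemma equal_derivatives_positive:
  fixes f g :: "real \<Rightarrow> 'b::real_normed_vector"
  assumes "\<And>r. r > 0 \<Longrightarrow> (f has_vector_derivative D r) (at r)"
    and "\<And>r. r > 0 \<Longrightarrow> (g has_vector_derivative D r) (at r)"
  shows "\<exists>c. \<forall>r>0. f r = g r + c"
proof -
  have "((\<lambda>r. f r - g r) has_vector_derivative 0) (at r within {0<..})" if "r \<in> {0<..}" for r
    using has_vector_derivative_diff[OF assms(1)[of r] assms(2)[of r]] that
    by (simp add: has_vector_derivative_at_within)
  then obtain c where "\<And>r. r \<in> {0<..} \<Longrightarrow> f r - g r = c"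
    using has_vector_derivative_zero_constant[of "{0<..}" "\<lambda>r. f r - g r"] by blast
  then show ?thesis by (intro exI[of _ c]) (auto simp: algebra_simps)
qed

text \<open>Cauchy's formula for inverting \<open>(1 / r) d/dr\<close> repeatedly. Each
  antiderivative adds one constant and raises the earlier even powers by two; the factors
  \<open>2 (k + 1)\<close> from differentiating the kernel multiply up to
  \<open>2 ^ m * fact m\<close>.\<close>

theorem iterated_radial_antiderivative:
  fixes h :: "nat \<Rightarrow> real \<Rightarrow> complex"
  assumes "\<And>j r. j \<le> m \<Longrightarrow> r > 0 \<Longrightarrow> (h j has_vector_derivative r *\<^sub>R h (Suc j) r) (at r)"
    and "continuous_on {0<..} (h (Suc m))" and a: "a > 0"
  shows "\<exists>c :: nat \<Rightarrow> complex. \<forall>r>0. h 0 r =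
    kernel_integral (\<lambda>\<tau>. of_real \<tau> * h (Suc m) \<tau>) m a r / of_real (2 ^ m * fact m)
    + (\<Sum>i\<le>m. c i * of_real (r ^ (2 * i)))"
  using assms(1,2)
proof (induction m arbitrary: h)
  case (0 h)
  let ?K = "kernel_integral (\<lambda>\<tau>. of_real \<tau> * h (Suc 0) \<tau>) 0 a"
  have dK: "(?K has_vector_derivative of_real r * h (Suc 0) r) (at r)" if "r > 0" for r
    using 0 a that by (intro kernel_integral_0_derivative continuous_intros) auto
  have dh: "(h 0 has_vector_derivative of_real r * h (Suc 0) r) (at r)" if "r > 0" for r
    using 0(1)[of 0 r] that by (simp add: scaleR_conv_of_real[where 'a=complex])
  obtain c where "\<And>r. r > 0 \<Longrightarrow> h 0 r = ?K r + c"
    using equal_derivatives_positive[OF dh dK] by blast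
  then show ?case by (intro exI[of _ "\<lambda>_. c"]) simp
next
  case (Suc m h)
  let ?e = "\<lambda>\<tau>. of_real \<tau> * h (Suc (Suc m)) \<tau>"
  let ?K = "\<lambda>k. kernel_integral ?e k a"
  have e: "continuous_on {0<..} ?e" by (intro continuous_intros Suc.prems(2))
  \<comment> \<open>The shifted sequence reaches \<open>h (Suc 0)\<close>; one further
    antiderivative is left.\<close>
  have "\<exists>c :: nat \<Rightarrow> complex. \<forall>r>0. h (Suc 0) r =
    ?K m r / of_real (2 ^ m * fact m) + (\<Sum>i\<le>m. c i * of_real (r ^ (2 * i)))"
    using Suc.IH[of "\<lambda>j. h (Suc j)"] Suc.prems by simp
  then obtain c :: "nat \<Rightarrow> complex" where c: "\<And>r. r > 0 \<Longrightarrow> h (Suc 0) r =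
    ?K m r / of_real (2 ^ m * fact m) + (\<Sum>i\<le>m. c i * of_real (r ^ (2 * i)))"
    by blast
  define F where "F r = ?K (Suc m) r / of_real (2 ^ Suc m * fact (Suc m)) +
      (\<Sum>i\<le>m. (c i / of_nat (2 * Suc i)) * of_real (r ^ (2 * Suc i)))" for r
  have dF: "(F has_vector_derivative of_real r * h (Suc 0) r) (at r)" if r: "r > 0" for r
  proof -
    have pow: "((\<lambda>r. (c i / of_nat (2 * Suc i)) * of_real (r ^ (2 * Suc i))) has_vector_derivative
        of_real r * (c i * of_real (r ^ (2 * i)))) (at r)" for i
    proof -
      have "((\<lambda>r. complex_of_real (r ^ (2 * Suc i))) has_vector_derivative
          of_real (real (2 * Suc i) * r ^ (2 * Suc i - Suc 0))) (at r)"
        by (intro has_vector_derivative_of_real DERIV_pow)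
      from has_vector_derivative_mult_right[OF this, of "c i / of_nat (2 * Suc i)"]
      show ?thesis by (simp add: mult_ac del: of_nat_Suc of_nat_mult of_nat_add)
    qed
    have "(F has_vector_derivative
        of_real (2 * real (Suc m) * r) * ?K m r / of_real (2 ^ Suc m * fact (Suc m)) +
        (\<Sum>i\<le>m. of_real r * (c i * of_real (r ^ (2 * i))))) (at r)"
      unfolding F_def
      by (intro has_vector_derivative_add has_vector_derivative_divide has_vector_derivative_sum pow
          kernel_integral_Suc_derivative e a r)
    moreover have "of_real (2 * real (Suc m) * r) * ?K m r / of_real (2 ^ Suc m * fact (Suc m)) =
        of_real r * (?K m r / of_real (2 ^ m * fact m))"
      by (simp add: field_simps del: of_nat_Suc)
    ultimately show ?thesis
      unfolding c[OF r] by (simp only: distrib_left sum_distrib_left)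
  qed
  have dh: "(h 0 has_vector_derivative of_real r * h (Suc 0) r) (at r)" if "r > 0" for r
    using Suc.prems(1)[of 0 r] that by (simp add: scaleR_conv_of_real[where 'a=complex])
  obtain d where d: "\<And>r. r > 0 \<Longrightarrow> h 0 r = F r + d"
    using equal_derivatives_positive[OF dh dF] by blast
  show ?case
  \<comment> \<open>The new integration constant takes index 0, and the integrated old coefficients
    move up by one.\<close>
  proof (intro exI[of _ "\<lambda>i. case i of 0 \<Rightarrow> d | Suc i \<Rightarrow> c i / of_nat (2 * Suc i)"] allI impI)
    fix r :: real assume r: "r > 0"
    show "h 0 r = ?K (Suc m) r / of_real (2 ^ Suc m * fact (Suc m)) +
      (\<Sum>i\<le>Suc m. (case i of 0 \<Rightarrow> d | Suc i \<Rightarrow> c i / of_nat (2 * Suc i)) * of_real (r ^ (2 * i)))"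
      unfolding d[OF r] F_def by (subst sum.atMost_Suc_shift) simp
  qed
qed

section \<open>Expansion coefficients as radial means, and the representation of
  \<open>f\<close>\<close>

lemma harmonic_coeff_radial_mean:
  fixes u :: "real ^ 'n \<Rightarrow> complex"
  assumes Q: "solid_harmonic m Q" and H: "\<And>\<theta>. \<theta> \<in> sphere 0 1 \<Longrightarrow> cnj (H \<theta>) = Q \<theta>"
    and r: "r > 0"
  shows "sphere_inner (\<lambda>\<theta>. u (r *\<^sub>R \<theta>)) H / of_real (r ^ m) =
    radial_mean (\<lambda>x. Q x * u x) r / of_real (r ^ (CARD('n) - 2 + 2 * m))"
proof -
  \<comment> \<open>Homogeneity of \<open>Q\<close> accounts for one factor \<open>r ^ m\<close> of
    the final denominator, the normalisation of the coefficient for the second, and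
    \<open>radial_mean\<close> for the rest.\<close>
  have "sphere_inner (\<lambda>\<theta>. u (r *\<^sub>R \<theta>)) H =
      (LINT \<theta>|sphere_measure 0 1. (Q (r *\<^sub>R \<theta>) * u (r *\<^sub>R \<theta>)) / of_real (r ^ m))"
    unfolding sphere_inner_def
  proof (rule Bochner_Integration.integral_cong[OF refl])
    fix \<theta> :: "real ^ 'n" assume "\<theta> \<in> space (sphere_measure 0 1)"
    then have "cnj (H \<theta>) = Q \<theta>" using H by simp
    moreover have "Q (r *\<^sub>R \<theta>) = of_real (r ^ m) * Q \<theta>"
      using Q r by (simp add: solid_harmonic_def)
    ultimately show "u (r *\<^sub>R \<theta>) * cnj (H \<theta>) = Q (r *\<^sub>R \<theta>) * u (r *\<^sub>R \<theta>) / of_real (r ^ m)"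
      using r by simp
  qed
  also have "\<dots> / of_real (r ^ m) =
      radial_mean (\<lambda>x. Q x * u x) r / of_real (r ^ (CARD('n) - 2 + 2 * m))"
    using r by (simp add: radial_mean_def scaleR_conv_of_real[where 'a=complex] power_add mult_2)
  finally show ?thesis .
qed

text \<open>The limit theorem applies to the smooth function \<open>spherical_mean f x t\<close> of
  \<open>x\<close>. The area factor in the limit cancels against the normalisation of the mean once
  the differential operator is moved onto \<open>f\<close>.\<close>

lemma harmonic_coeff_spherical_mean_0:
  fixes f :: "real ^ 'n \<Rightarrow> complex"
  assumes n: "CARD('n) \<ge> 2" and f: "C_infinity f" and t: "t > 0"
    and Q: "solid_harmonic m Q" and H: "\<And>\<theta>. \<theta> \<in> sphere 0 1 \<Longrightarrow> cnj (H \<theta>) = Q \<theta>"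
  shows "harmonic_coeff m H (\<lambda>x. spherical_mean f x t) 0 =
    (LINT \<theta>|sphere_measure 0 1. harmonic_transfer m m Q f (t *\<^sub>R \<theta>)) /
      of_real (\<Prod>j<m. real (CARD('n) + 2 * j))"
proof -
  let ?u = "\<lambda>x. spherical_mean f x t" and ?A = "sphere_area TYPE(real ^ 'n)"
  let ?P = "\<Prod>j<m. real (CARD('n) + 2 * j)"
  have A: "?A > 0" by (rule sphere_area_pos)
  have cont: "continuous_on UNIV (harmonic_transfer m m Q f)"
    using Q f by (auto intro!: harmonic_transfer_continuous simp: solid_harmonic_def)
  have "((\<lambda>r. radial_mean (\<lambda>x. Q x * ?u x) r / of_real (r ^ (CARD('n) - 2 + 2 * m))) \<longlongrightarrow>
      of_real (?A / ?P) * harmonic_transfer m m Q ?u 0) (at_right 0)"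
    by (rule radial_mean_limit[OF Q C_infinity_spherical_mean[OF f t] n])
  moreover have "\<forall>\<^sub>F r in at_right 0. radial_mean (\<lambda>x. Q x * ?u x) r / of_real (r ^ (CARD('n) - 2 + 2 * m)) =
      sphere_inner (\<lambda>\<theta>. ?u (r *\<^sub>R \<theta>)) H / of_real (r ^ m)"
    unfolding eventually_at_right_field
    using harmonic_coeff_radial_mean[OF Q H, of _ ?u] by (intro exI[of _ 1]) auto
  ultimately have "((\<lambda>r. sphere_inner (\<lambda>\<theta>. ?u (r *\<^sub>R \<theta>)) H / of_real (r ^ m)) \<longlongrightarrow>
      of_real (?A / ?P) * harmonic_transfer m m Q ?u 0) (at_right 0)"
    by (rule Lim_transform_eventually)
  then have "harmonic_coeff m H ?u 0 = of_real (?A / ?P) * harmonic_transfer m m Q ?u 0"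
    by (simp add: harmonic_coeff_def tendsto_Lim)
  also have "harmonic_transfer m m Q ?u 0 =
      (LINT \<theta>|sphere_measure 0 1. harmonic_transfer m m Q f (t *\<^sub>R \<theta>)) / of_real ?A"
    unfolding harmonic_transfer_spherical_mean[OF Q f t]
    by (simp add: spherical_mean_eq[OF t cont])
  finally show ?thesis using A by simp
qed

theorem theorem3p4:
  fixes f :: "real ^ 'n \<Rightarrow> complex"
    and Y :: "nat \<Rightarrow> nat \<Rightarrow> real ^ 'n \<Rightarrow> complex"
    and L :: "nat \<Rightarrow> nat"
    and a A :: real
  assumes "CARD('n) \<ge> 2"
    and "0 < a" and "a < A"
    and "C_infinity f"
    and "\<forall>m. orthonormal_basis_harmonics m (L m) (Y m)"
  shows "\<forall>m. \<forall>l\<in>{1..L m}. \<exists>c :: nat \<Rightarrow> complex. \<forall>r>0.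
    harmonic_coeff m (Y m l) f r
      - k_coeff CARD('n) a m
          (\<lambda>\<tau>. harmonic_coeff m (Y m l) (\<lambda>x. spherical_mean f x \<tau>) 0) r
    = (if m \<ge> 1 then \<Sum>i=0..m-1. c i * of_real (r powi (- int CARD('n) - 2 * int i)) else 0)"
proof (intro allI ballI)
  fix m l assume l: "l \<in> {1..L m}"
  let ?n = "CARD('n)"
  note n = assms(1) and a = assms(2) and f = assms(4)
  have "spherical_harmonic m (Y m l)"
    using assms(5) l unfolding orthonormal_basis_harmonics_def by blast
  then obtain Q where Q: "solid_harmonic m Q" and H: "\<And>\<theta>. \<theta> \<in> sphere 0 1 \<Longrightarrow> cnj (Y m l \<theta>) = Q \<theta>"
    by (rule spherical_harmonic_cnj_solid) blast
  define E where "E = harmonic_transfer m m Q f"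
  define I where "I \<tau> = (LINT \<theta>|sphere_measure 0 1. E (\<tau> *\<^sub>R \<theta>))" for \<tau>
  define P where "P = (\<Prod>j<m. real (?n + 2 * j))"
  define g where "g \<tau> = harmonic_coeff m (Y m l) (\<lambda>x. spherical_mean f x \<tau>) 0" for \<tau>
  have P: "P > 0" unfolding P_def using n by (intro prod_pos) simp
  have g: "g \<tau> = I \<tau> / of_real P" if "\<tau> > 0" for \<tau>
    unfolding g_def I_def E_def P_def by (rule harmonic_coeff_spherical_mean_0[OF n f that Q H])
  have F: "harmonic_coeff m (Y m l) f r =
      radial_mean (\<lambda>x. Q x * f x) r / of_real (r ^ (?n - 2 + 2 * m))" if "r > 0" for r
    using harmonic_coeff_radial_mean[OF Q H that, of f] that by (simp add: harmonic_coeff_def)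
  show "\<exists>c :: nat \<Rightarrow> complex. \<forall>r>0. harmonic_coeff m (Y m l) f r -
      k_coeff ?n a m (\<lambda>\<tau>. harmonic_coeff m (Y m l) (\<lambda>x. spherical_mean f x \<tau>) 0) r
    = (if m \<ge> 1 then \<Sum>i=0..m-1. c i * of_real (r powi (- int ?n - 2 * int i)) else 0)"
    unfolding g_def[symmetric]
  proof (cases m)
    case 0
    \<comment> \<open>In degree zero the product \<open>P\<close> is empty and no differentiation
      occurs, so both coefficients are the same sphere integral.\<close>
    have "harmonic_coeff m (Y m l) f r = k_coeff ?n a m g r" if "r > 0" for r
      using F[OF that] g[OF that] that 0
      by (simp add: k_coeff_def P_def I_def E_def radial_mean_def scaleR_conv_of_real[where 'a=complex])
    then show "\<exists>c :: nat \<Rightarrow> complex. \<forall>r>0. harmonic_coeff m (Y m l) f r - k_coeff ?n a m g r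
      = (if m \<ge> 1 then \<Sum>i=0..m-1. c i * of_real (r powi (- int ?n - 2 * int i)) else 0)"
      using 0 by simp
  next
    case (Suc k)
    define h where "h j = radial_mean (harmonic_transfer j m Q f)" for j
    have hm: "h (Suc k) \<tau> = of_real (\<tau> ^ (?n - 2)) * I \<tau>" for \<tau>
      by (simp add: h_def radial_mean_def I_def E_def Suc scaleR_conv_of_real[where 'a=complex])
    have "continuous_on UNIV E"
      using Q f unfolding E_def by (auto intro!: harmonic_transfer_continuous simp: solid_harmonic_def)
    then have "isCont I \<tau>" for \<tau>
      unfolding I_def by (rule isCont_sphere_integral)
    then have "continuous_on {0<..} I"
      by (simp add: continuous_at_imp_continuous_on)
    then have "continuous_on {0<..} (h (Suc k))"
      unfolding hm by (intro continuous_intros)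
    moreover have "(h j has_vector_derivative r *\<^sub>R h (Suc j) r) (at r)" if "j \<le> k" "r > 0" for j r
      unfolding h_def by (rule radial_mean_transfer_derivative[OF Q _ f]) (use that n Suc in auto)
    \<comment> \<open>The integration constants \<open>c\<close> are all that separates the
      coefficient of \<open>f\<close> from \<open>k_coeff\<close>.\<close>
    ultimately obtain c :: "nat \<Rightarrow> complex" where c: "\<And>r. r > 0 \<Longrightarrow> h 0 r =
        kernel_integral (\<lambda>\<tau>. of_real \<tau> * h (Suc k) \<tau>) k a r / of_real (2 ^ k * fact k)
        + (\<Sum>i\<le>k. c i * of_real (r ^ (2 * i)))"
      using iterated_radial_antiderivative[of k h a] a by blast
    have "harmonic_coeff m (Y m l) f r - k_coeff ?n a m g r =
        (\<Sum>i=0..k. c (k - i) * of_real (r powi (- int ?n - 2 * int i)))" if r: "r > 0" for r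
    proof -
      have "kernel_integral (\<lambda>\<tau>. of_real \<tau> * h (Suc k) \<tau>) k a r =
          (LBINT \<tau>=a..r. of_real P * (g \<tau> * of_real (\<tau> ^ (?n - 1) * (r\<^sup>2 - \<tau>\<^sup>2) ^ k)))"
        unfolding kernel_integral_def
      proof (rule interval_integral_cong)
        fix \<tau> assume "\<tau> \<in> einterval (min (ereal a) (ereal r)) (max (ereal a) (ereal r))"
        \<comment> \<open>The integration variable lies between \<open>a\<close> and
          \<open>r\<close> in either order, so the formula for \<open>g\<close> at positive
          arguments also covers \<open>r < a\<close>.\<close>
        then have \<tau>: "\<tau> > 0" using a r by (auto simp: einterval_def min_def split: if_splits)
        \<comment> \<open>The weight of \<open>k_coeff\<close> combines the power in
          \<open>radial_mean\<close> with the extra \<open>\<tau>\<close> from inverting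
          \<open>(1 / r) d/dr\<close>.\<close>
        have "\<tau> ^ (?n - 1) = \<tau> * \<tau> ^ (?n - 2)"
          using n by (simp flip: power_Suc add: Suc_diff_Suc numeral_2_eq_2)
        then show "of_real \<tau> * h (Suc k) \<tau> * of_real ((r\<^sup>2 - \<tau>\<^sup>2) ^ k) =
            of_real P * (g \<tau> * of_real (\<tau> ^ (?n - 1) * (r\<^sup>2 - \<tau>\<^sup>2) ^ k))"
          using P by (simp add: hm g[OF \<tau>] mult_ac)
      qed
      also have "\<dots> = of_real P * (LBINT \<tau>=a..r. g \<tau> * of_real (\<tau> ^ (?n - 1) * (r\<^sup>2 - \<tau>\<^sup>2) ^ k))"
        by simp
      finally have K: "kernel_integral (\<lambda>\<tau>. of_real \<tau> * h (Suc k) \<tau>) k a r = \<dots>" .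
      have exp: "?n - 2 + 2 * m = ?n + 2 * k" using n Suc by simp
      have "k_coeff ?n a m g r = kernel_integral (\<lambda>\<tau>. of_real \<tau> * h (Suc k) \<tau>) k a r
          / of_real (2 ^ k * fact k) / of_real (r ^ (?n + 2 * k))"
      proof -
        have "k_coeff ?n a m g r = of_real (P / (2 ^ k * fact k) * inverse (r ^ (?n + 2 * k))) *
            (LBINT \<tau>=a..r. g \<tau> * of_real (\<tau> ^ (?n - 1) * (r\<^sup>2 - \<tau>\<^sup>2) ^ k))"
          unfolding k_coeff_def P_def Suc by (simp only: power_int_minus power_int_of_nat) simp
        then show ?thesis
          unfolding K by (simp only: of_real_mult of_real_divide of_real_inverse divide_inverse mult_ac)
      qed
      moreover have "harmonic_coeff m (Y m l) f r = h 0 r / of_real (r ^ (?n + 2 * k))"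
        using F[OF r] by (simp add: h_def exp)
      ultimately have "harmonic_coeff m (Y m l) f r - k_coeff ?n a m g r =
          (\<Sum>i\<le>k. c i * of_real (r ^ (2 * i))) / of_real (r ^ (?n + 2 * k))"
        unfolding c[OF r] by (simp add: add_divide_distrib)
      also have "\<dots> = (\<Sum>i\<le>k. c i * of_real (r ^ (2 * i) / r ^ (?n + 2 * k)))"
        by (simp add: sum_divide_distrib)
      \<comment> \<open>Dividing turns the power \<open>2 i\<close> into
        \<open>-n - 2 (k - i)\<close>, so reversing the summation gives the exponents in the stated
        order.\<close>
      also have "\<dots> = (\<Sum>i\<le>k. c (k - i) * of_real (r ^ (2 * (k - i)) / r ^ (?n + 2 * k)))"
        using sum.nat_diff_reindex[of "\<lambda>i. c i * of_real (r ^ (2 * i) / r ^ (?n + 2 * k))" "Suc k"]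
        by (simp add: lessThan_Suc_atMost)
      also have "\<dots> = (\<Sum>i\<le>k. c (k - i) * of_real (r powi (- int ?n - 2 * int i)))"
      proof (rule sum.cong[OF refl])
        fix i assume i: "i \<in> {..k}"
        have "?n + 2 * k = 2 * (k - i) + (?n + 2 * i)"
          using i by simp
        then have "r ^ (?n + 2 * k) = r ^ (2 * (k - i)) * r ^ (?n + 2 * i)"
          by (simp only: power_add)
        then have "r ^ (2 * (k - i)) / r ^ (?n + 2 * k) = inverse (r ^ (?n + 2 * i))"
          using r by (simp add: field_simps)
        also have "\<dots> = r powi (- int (?n + 2 * i))"
          by (simp only: power_int_minus power_int_of_nat)
        also have "- int (?n + 2 * i) = - int ?n - 2 * int i" by simp
        finally show "c (k - i) * of_real (r ^ (2 * (k - i)) / r ^ (?n + 2 * k)) =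
            c (k - i) * of_real (r powi (- int ?n - 2 * int i))" by simp
      qed
      finally show ?thesis by (simp add: atLeast0AtMost)
    qed
    then show "\<exists>c :: nat \<Rightarrow> complex. \<forall>r>0. harmonic_coeff m (Y m l) f r - k_coeff ?n a m g r
      = (if m \<ge> 1 then \<Sum>i=0..m-1. c i * of_real (r powi (- int ?n - 2 * int i)) else 0)"
      by (intro exI[of _ "\<lambda>i. c (k - i)"]) (simp add: Suc)
  qed
qed

end
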